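(* Suppose $T$ is a perforated tableau. Let $T' = T\otimes (s)_{a}$ denote the perforated tableau produced by adjoining one cell with value $s$ in row $a$, such that the extension produces a valid ptableau. Then \begin{enumerate} \item Given any sequence of crystal operators $e^{*} = e_{i_s} \cdots e_{i_1}$ such that $e^{*}T$ is highest weight, there is a sequence $e^{**}$ determined only by $e^{*}$, the values $\phi_{i_{\ell}}(e_{i_{\ell-1}} \cdots e_{i_1} T)$, and the row index $a$, such that $e^{**}T'$ is highest weight. In particular, $e^{**}$ is independent of the value $s$, except that we require $T\otimes (s)_{a}$ to be a valid ptableau. \item The highest weight ptableau $e^{**}T'$ extends the highest weight ptableau $e^{*}T$. That is, $e^{**}T'$ has the form of the highest weight ptableau $e^{*}T$ to which a cell with content $s$ has been appended, in some row, to produce a partition-shaped ptableau. \end{enumerate}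
   Context: A perforated tableau (ptableau) is a rectangular array whose boxes are either blank or are cells containing positive integers, such that for each $i$ the $i$'s form a horizontal strip, for $i<j$ no $j$ lies in a higher row or in a column to the left of a column containing an $i$, and the number of columns is minimal (no all-blank columns). Ptableaux obtained from one another by swapping blanks with adjacent cells in the same row (keeping validity) are identified; ${}^*T$ and $T^*$ denote the left- and right-justified forms. For $1\le i<n$, $T[i,i+1]$ denotes rows $i,i+1$ of $T$ (all-blank columns removed). The crystal operator $e_i(T)$ moves up into row $i$ the cell of row $i+1$ corresponding to the right-most cell of row $i+1$ having a blank above it in ${}^*T[i,i+1]$ (NULL if none); $f_i(T)$ moves down the cell of row $i$ corresponding to the left-most cell of row $i$ with a blank below it in $T[i,i+1]^*$; $\phi_i(T)$ is the number of blanks in row $i+1$ of $T[i,i+1]^*$. A ptableau is highest weight iff its left-justified form is a semistandard Young tableau. Each ptableau $T$ corresponds to a biword with a column $\binom{\tau_i}{\omega_i}$ for each content $\tau_i$ in row $\omega_i$, written in standard form ($\tau$ weakly increasing, and $\omega$ weakly decreasing under equal letters of $\tau$). The extension $T\otimes(s)_a$ is $T$ with a cell of content $s$ appended to row $a$, required to correspond to appending the column $\binom{s}{a}$ at the end of the biword of $T$ with the result still in standard form.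
   Formalization: The sequence e** is determined by e*, the listed φ values, the row a, and additionally the values φ_j(e*T) for 1 ≤ j < n; without these the claim fails (n=2, e* empty, a=2, s=2: T a single 1 in row 1 versus T the column 1/2). *)

theory Defs
  imports Main
begin

text \<open>
  A rectangular array is the list of its columns. A column maps a row number to the content
  of the cell in that row, and to None if that box is blank. Rows are numbered
  from 1 (top row), columns from 0 (list positions).
\<close>

type_synonym parray = "(nat \<Rightarrow> nat option) list"

definition cells :: "parray \<Rightarrow> (nat \<times> nat) set" where
  "cells T = {(r, c). c < length T \<and> (T ! c) r \<noteq> None}"

definition row_word :: "parray \<Rightarrow> nat \<Rightarrow> nat list" where
  "row_word T r = map (\<lambda>col. the (col r)) (filter (\<lambda>col. col r \<noteq> None) T)"

definition drop_blank_columns :: "parray \<Rightarrow> parray" where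
  "drop_blank_columns T = filter (\<lambda>col. col \<noteq> Map.empty) T"

text \<open>
  Cells with the same content form a horizontal strip if, of any two of them in different rows,
  the lower one lies strictly to the left.
\<close>

definition horizontal_strip :: "(nat \<times> nat) set \<Rightarrow> bool" where
  "horizontal_strip A \<longleftrightarrow> (\<forall>r c r' c'. (r, c) \<in> A \<and> (r', c') \<in> A \<and> r < r' \<longrightarrow> c' < c)"

text \<open>
  The last clause says that no larger content lies weakly above and weakly to the left
  of a smaller one.
\<close>

definition filling :: "parray \<Rightarrow> bool" where
  "filling T \<longleftrightarrow>
     (\<forall>(r, c) \<in> cells T. 1 \<le> r \<and> 1 \<le> the ((T ! c) r)) \<and>
     (\<forall>x. horizontal_strip {(r, c) \<in> cells T. (T ! c) r = Some x}) \<and>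
     (\<forall>(r, c) \<in> cells T. \<forall>(r', c') \<in> cells T.
        r \<le> r' \<and> c \<le> c' \<longrightarrow> \<not> the ((T ! c') r') < the ((T ! c) r))"

definition move_cell :: "nat \<Rightarrow> nat \<Rightarrow> nat \<Rightarrow> parray \<Rightarrow> parray" where
  "move_cell r c d T = T[c := (T ! c)(r := None), d := (T ! d)(r := (T ! c) r)]"

definition left_swap :: "parray \<Rightarrow> parray \<Rightarrow> bool" where
  "left_swap T S \<longleftrightarrow> (\<exists>r c. (r, Suc c) \<in> cells T \<and> (r, c) \<notin> cells T \<and>
     S = move_cell r (Suc c) c T \<and> filling S)"

definition right_swap :: "parray \<Rightarrow> parray \<Rightarrow> bool" where
  "right_swap T S \<longleftrightarrow> (\<exists>r c. (r, c) \<in> cells T \<and> (r, Suc c) \<notin> cells T \<and> Suc c < length T \<and>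
     S = move_cell r c (Suc c) T \<and> filling S)"

text \<open>The identification of arrays that are obtained from one another by swaps.\<close>

definition same_ptableau :: "parray \<Rightarrow> parray \<Rightarrow> bool" where
  "same_ptableau = (\<lambda>T S. left_swap T S \<or> right_swap T S)\<^sup>*\<^sup>*"

text \<open>
  A perforated tableau with rows \<open>1, \<dots>, n\<close>. The number of columns is minimal if no sequence
  of swaps produces an all-blank column, which could then be removed; the empty sequence of swaps
  shows that T itself has no such column.
\<close>

definition ptableau :: "nat \<Rightarrow> parray \<Rightarrow> bool" where
  "ptableau n T \<longleftrightarrow> filling T \<and> (\<forall>col \<in> set T. dom col \<subseteq> {1..n}) \<and>
     (\<forall>S. same_ptableau T S \<longrightarrow> Map.empty \<notin> set S)"

text \<open>
  The array in which no cell can be moved further to the left (right) is unique, so the choice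
  in the following two definitions is immaterial.
\<close>

definition left_justified :: "parray \<Rightarrow> parray" where
  "left_justified T = drop_blank_columns (SOME S. left_swap\<^sup>*\<^sup>* T S \<and> (\<nexists>S'. left_swap S S'))"

definition right_justified :: "parray \<Rightarrow> parray" where
  "right_justified T = drop_blank_columns (SOME S. right_swap\<^sup>*\<^sup>* T S \<and> (\<nexists>S'. right_swap S S'))"

text \<open>\<open>T[i,i+1]\<close>; the two rows keep their numbers.\<close>

definition two_rows :: "nat \<Rightarrow> parray \<Rightarrow> parray" where
  "two_rows i T = drop_blank_columns (map (\<lambda>col. col |` {i, Suc i}) T)"

definition phi :: "nat \<Rightarrow> parray \<Rightarrow> nat" where
  "phi i T = (let S = right_justified (two_rows i T)
              in card {c. c < length S \<and> (Suc i, c) \<notin> cells S})"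

definition move_up :: "nat \<Rightarrow> nat \<Rightarrow> parray \<Rightarrow> parray" where
  "move_up i c S = S[c := (S ! c)(i := (S ! c) (Suc i), Suc i := None)]"

text \<open>
  The crystal operator \<open>e\<^sub>i\<close>, with None for NULL. The cell is moved up inside the left-justified
  form of \<open>T[i,i+1]\<close>; the result is the ptableau having the two rows obtained in this way,
  and the other rows of T. A ptableau is determined, up to swaps, by the contents of
  its rows, so the choice only selects a representative.
\<close>

definition crystal_e :: "nat \<Rightarrow> nat \<Rightarrow> parray \<Rightarrow> parray option" where
  "crystal_e n i T =
     (let S = left_justified (two_rows i T);
          C = {c. (Suc i, c) \<in> cells S \<and> (i, c) \<notin> cells S}
      in if C = {} then None
         else Some (SOME T'. ptableau n T' \<and>
           (\<forall>r. row_word T' r =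
              (if r \<in> {i, Suc i} then row_word (move_up i (Max C) S) r else row_word T r))))"

text \<open>The list \<open>[i\<^sub>1, \<dots>, i\<^sub>s]\<close> stands for the composition in which \<open>e\<close> with index \<open>i\<^sub>1\<close> acts first.\<close>

fun crystal_e_seq :: "nat \<Rightarrow> nat list \<Rightarrow> parray \<Rightarrow> parray option" where
  "crystal_e_seq n [] T = Some T"
| "crystal_e_seq n (i # ks) T = Option.bind (crystal_e n i T) (crystal_e_seq n ks)"

text \<open>
  The list of the values of \<open>\<phi>\<close> with index \<open>i\<^sub>l\<close> at \<open>T\<close> after the operators
  with indices \<open>i\<^sub>1, \<dots>, i\<^bsub>l-1\<^esub>\<close>. Nothing is recorded after a NULL.
\<close>

fun phi_seq :: "nat \<Rightarrow> nat list \<Rightarrow> parray \<Rightarrow> nat list" where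
  "phi_seq n [] T = []"
| "phi_seq n (i # ks) T =
     phi i T # (case crystal_e n i T of None \<Rightarrow> [] | Some S \<Rightarrow> phi_seq n ks S)"

definition partition_shaped :: "parray \<Rightarrow> bool" where
  "partition_shaped S \<longleftrightarrow>
     (\<forall>(r, c) \<in> cells S. 1 \<le> r \<and> (\<forall>r' c'. 1 \<le> r' \<and> r' \<le> r \<and> c' \<le> c \<longrightarrow> (r', c') \<in> cells S))"

definition semistandard :: "parray \<Rightarrow> bool" where
  "semistandard S \<longleftrightarrow> partition_shaped S \<and>
     (\<forall>r c. (r, c) \<in> cells S \<and> (r, Suc c) \<in> cells S \<longrightarrow> the ((S ! c) r) \<le> the ((S ! Suc c) r)) \<and>
     (\<forall>r c. (r, c) \<in> cells S \<and> (Suc r, c) \<in> cells S \<longrightarrow> the ((S ! c) r) < the ((S ! c) (Suc r)))"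

definition highest_weight :: "parray \<Rightarrow> bool" where
  "highest_weight T \<longleftrightarrow> semistandard (left_justified T)"

text \<open>A biword is the list of its columns \<open>(\<tau>, \<omega>)\<close>.\<close>

definition standard_form :: "(nat \<times> nat) list \<Rightarrow> bool" where
  "standard_form bw \<longleftrightarrow>
     sorted_wrt (\<lambda>(t, w) (t', w'). t < t' \<or> t = t' \<and> w' \<le> w) bw"

definition biword_of :: "parray \<Rightarrow> (nat \<times> nat) list \<Rightarrow> bool" where
  "biword_of T bw \<longleftrightarrow> standard_form bw \<and>
     (\<forall>t w. count_list bw (t, w) = card {c. c < length T \<and> (T ! c) w = Some t})"

text \<open>\<open>T'\<close> is (a representative of) the ptableau \<open>T \<otimes> (s)\<^sub>a\<close>.\<close>

definition extension :: "nat \<Rightarrow> parray \<Rightarrow> nat \<Rightarrow> nat \<Rightarrow> parray \<Rightarrow> bool" where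
  "extension n T s a T' \<longleftrightarrow> ptableau n T \<and> ptableau n T' \<and>
     (\<exists>bw. biword_of T bw \<and> biword_of T' (bw @ [(s, a)]))"

end

theory Submission
  imports Defs "HOL-Library.Sublist" "HOL-Library.Multiset"
begin

text \<open>
  Up to swaps a ptableau is determined by its row words, and \<open>T \<otimes> (s)\<^sub>a\<close> appends \<open>s\<close> to the
  row word of row \<open>a\<close>. Since \<open>s\<close> is a last entry of the biword, adjoining it to a left-justified
  pair of rows leaves all the other cells in place. This gives the tensor product rule:
  \<open>e\<^sub>i(T \<otimes> (s)\<^sub>a) = e\<^sub>i(T) \<otimes> (s)\<^sub>a\<close>, except that
  \<open>e\<^sub>i(T \<otimes> (s)\<^sub>a) = T \<otimes> (s)\<^sub>i\<close> if \<open>a = i+1\<close> and \<open>\<phi>\<^sub>i(T) = 0\<close>.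
  So \<open>e\<^sup>*\<^sup>*\<close> follows \<open>e\<^sup>*\<close>, with \<open>e\<^sub>i\<close> doubled in the exceptional case, and reaches
  \<open>U \<otimes> (s)\<^sub>b\<close>, where \<open>U\<close> is highest weight; then the new cell is raised as long as
  \<open>\<phi>\<^bsub>b-1\<^esub>(U) = 0\<close>, that is, as long as rows \<open>b-1\<close> and \<open>b\<close> of \<open>U\<close> have equal length.
\<close>

section \<open>Row words and pushing cells to the left\<close>

text \<open>The operators e_i are read off left-justified forms and \<phi>_i off right-justified
  ones, both through an arbitrary choice among swap sequences. Both forms are therefore replaced by
  a greedy packing, which depends on the row words only and has the fewest possible columns.
  Equality of the two column counts turns \<phi>_i(T) into the number of columns of the
  left-justified T[i,i+1] without a cell in row i+1. If there is such a column, a new cell in row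
  i+1 settles under a cell of row i and is no candidate for e_i; if there is none, it opens a last
  column with a blank above it and is itself the candidate. That is the exceptional case, and the
  second e_i then does to T what the single one would have done. None of these decisions looks at s.
  The final raising consults the values \<phi>_j(U), which is why \<open>E\<close> receives them as
  well.\<close>

lemma row_word_simps [simp]:
  "row_word [] r = []"
  "row_word (col # T) r = (case col r of None \<Rightarrow> row_word T r | Some x \<Rightarrow> x # row_word T r)"
  "row_word (S @ T) r = row_word S r @ row_word T r"
  by (auto simp: row_word_def split: option.split)

lemma in_row_word: "x \<in> set (row_word T r) \<longleftrightarrow> (\<exists>col\<in>set T. col r = Some x)"
  by (induction T) (auto split: option.split)

lemma row_word_eq_Nil: "row_word T r = [] \<longleftrightarrow> (\<forall>col\<in>set T. col r = None)"
  by (induction T) (auto split: option.split)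

lemma length_row_word: "length (row_word T r) = length (filter (\<lambda>col. col r \<noteq> None) T)"
  by (simp add: row_word_def)

lemma row_word_drop_blank [simp]: "row_word (drop_blank_columns T) = row_word T"
proof
  fix r show "row_word (drop_blank_columns T) r = row_word T r"
    by (induction T) (auto simp: drop_blank_columns_def split: option.split)
qed

lemma drop_blank_eq: "Map.empty \<notin> set T \<Longrightarrow> drop_blank_columns T = T"
  by (auto simp: drop_blank_columns_def filter_id_conv)

lemma drop_blank_no_blank: "Map.empty \<notin> set (drop_blank_columns T)"
  by (simp add: drop_blank_columns_def)

lemma drop_blank_Nil: "(\<And>r. row_word T r = []) \<Longrightarrow> drop_blank_columns T = []"
  by (auto simp: drop_blank_columns_def filter_empty_conv row_word_eq_Nil)

text \<open>\<open>P r x r' y\<close> is to say that x in row r may stand in the same column as y in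
  row r' or in one earlier in the list. Keeping \<open>P\<close> abstract lets one packing argument
  serve both justifications.\<close>

definition col_compat :: "(nat \<Rightarrow> nat \<Rightarrow> nat \<Rightarrow> nat \<Rightarrow> bool) \<Rightarrow> (nat \<Rightarrow> nat option) \<Rightarrow> (nat \<Rightarrow> nat option) \<Rightarrow> bool" where
  "col_compat P c d \<longleftrightarrow> (\<forall>r x r' y. c r = Some x \<longrightarrow> d r' = Some y \<longrightarrow> P r x r' y)"

definition spread :: "(nat \<Rightarrow> nat \<Rightarrow> nat \<Rightarrow> nat \<Rightarrow> bool) \<Rightarrow> parray \<Rightarrow> bool" where
  "spread P T \<longleftrightarrow> sorted_wrt (col_compat P) T \<and> (\<forall>c\<in>set T. col_compat P c c)"

abbreviation (input) nw_order :: "nat \<Rightarrow> nat \<Rightarrow> nat \<Rightarrow> nat \<Rightarrow> bool" where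
  "nw_order r x r' y \<equiv> r \<le> r' \<longrightarrow> x \<le> y \<and> (r < r' \<longrightarrow> x < y)"

text \<open>A cell moving left within its row can violate \<open>nw_order\<close> only against a
  cell below it: with the cells above it, in the column that it enters, the order held before the
  move. So this weaker relation decides all left moves, and \<open>above_lt\<close> all right
  moves.\<close>

abbreviation (input) below_gt :: "nat \<Rightarrow> nat \<Rightarrow> nat \<Rightarrow> nat \<Rightarrow> bool" where
  "below_gt r x r' y \<equiv> r < r' \<longrightarrow> x < y"

abbreviation (input) above_lt :: "nat \<Rightarrow> nat \<Rightarrow> nat \<Rightarrow> nat \<Rightarrow> bool" where
  "above_lt r x r' y \<equiv> r' < r \<longrightarrow> y < x"

text \<open>Of two cells, the second strictly lower and weakly further right, the last clause of
  \<open>filling\<close> forbids a larger first entry and the strip clause an equal one. Together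
  they become one pairwise relation between columns, which is stable under deleting columns.\<close>

lemma filling_iff:
  "filling T \<longleftrightarrow> spread nw_order T \<and> (\<forall>c\<in>set T. \<forall>r x. c r = Some x \<longrightarrow> 1 \<le> r \<and> 1 \<le> x)"
    (is "_ \<longleftrightarrow> ?R")
proof
  assume f: "filling T"
  have pos: "1 \<le> r \<and> 1 \<le> x" if "c < length T" "(T ! c) r = Some x" for c r x
    using f that unfolding filling_def cells_def by fastforce
  have ord: "nw_order r x r' y"
    if "c < length T" "d < length T" "c \<le> d" "(T ! c) r = Some x" "(T ! d) r' = Some y" for c d r x r' y
  proof -
    have "\<forall>(r, c)\<in>cells T. \<forall>(r', c')\<in>cells T.
        r \<le> r' \<and> c \<le> c' \<longrightarrow> \<not> the ((T ! c') r') < the ((T ! c) r)"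
      using f unfolding filling_def by blast
    then have "r \<le> r' \<longrightarrow> \<not> the ((T ! d) r') < the ((T ! c) r)"
      using that unfolding cells_def by blast
    then have "r \<le> r' \<longrightarrow> \<not> y < x"
      using that by simp
    moreover have "x \<noteq> y" if "r < r'"
    proof
      assume "x = y"
      have "horizontal_strip {(r, c) \<in> cells T. (T ! c) r = Some x}"
        using f unfolding filling_def by blast
      moreover have "(r, c) \<in> {(r, c) \<in> cells T. (T ! c) r = Some x}"
        "(r', d) \<in> {(r, c) \<in> cells T. (T ! c) r = Some x}"
        using \<open>c < length T\<close> \<open>d < length T\<close> \<open>(T ! c) r = Some x\<close> \<open>(T ! d) r' = Some y\<close> \<open>x = y\<close>
        by (auto simp: cells_def)
      ultimately have "d < c"
        using \<open>r < r'\<close> unfolding horizontal_strip_def by blast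
      then show False using \<open>c \<le> d\<close> by simp
    qed
    ultimately show ?thesis by force
  qed
  show ?R
    unfolding spread_def sorted_wrt_iff_nth_less col_compat_def
  proof (intro conjI allI impI ballI)
    fix c d r x r' y
    assume "c < d" "d < length T" "(T ! c) r = Some x" "(T ! d) r' = Some y" "r \<le> r'"
    with ord[of c d r x r' y] show "x \<le> y" by simp
  next
    fix c d r x r' y
    assume "c < d" "d < length T" "(T ! c) r = Some x" "(T ! d) r' = Some y" "r \<le> r'" "r < r'"
    with ord[of c d r x r' y] show "x < y" by simp
  next
    fix c r x r' y
    assume c: "c \<in> set T" "c r = Some x" "c r' = Some y" "r \<le> r'"
    then obtain k where "k < length T" "c = T ! k" by (metis in_set_conv_nth)
    with c ord[of k k r x r' y] show "x \<le> y" "r < r' \<Longrightarrow> x < y" by simp_all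
  next
    fix c r x
    assume "c \<in> set T" "c r = Some x"
    with pos show "1 \<le> r" "1 \<le> x" by (metis in_set_conv_nth)+
  qed
next
  assume R: ?R
  then have ord: "nw_order r x r' y"
    if "c < length T" "d < length T" "c \<le> d" "(T ! c) r = Some x" "(T ! d) r' = Some y" for c d r x r' y
  proof -
    have "col_compat nw_order (T ! c) (T ! d)"
      using R that unfolding spread_def sorted_wrt_iff_nth_less by (cases "c = d") auto
    then show ?thesis
      using that unfolding col_compat_def by blast
  qed
  have pos: "1 \<le> r \<and> 1 \<le> x" if "c < length T" "(T ! c) r = Some x" for c r x
    using R that nth_mem by blast
  show "filling T"
    unfolding filling_def
  proof (intro conjI allI)
    show "\<forall>(r, c)\<in>cells T. 1 \<le> r \<and> 1 \<le> the ((T ! c) r)"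
      using pos by (auto simp: cells_def)
    show "horizontal_strip {(r, c). (r, c) \<in> cells T \<and> (T ! c) r = Some x}" for x
      unfolding horizontal_strip_def
    proof (intro allI impI, elim conjE)
      fix r c r' c'
      assume "(r, c) \<in> {(r, c). (r, c) \<in> cells T \<and> (T ! c) r = Some x}"
        "(r', c') \<in> {(r, c). (r, c) \<in> cells T \<and> (T ! c) r = Some x}" "r < r'"
      then show "c' < c"
        using ord[of c c' r x r' x] by (auto simp: cells_def not_less[symmetric])
    qed
    show "\<forall>(r, c)\<in>cells T. \<forall>(r', c')\<in>cells T.
       r \<le> r' \<and> c \<le> c' \<longrightarrow> \<not> the ((T ! c') r') < the ((T ! c) r)"
    proof clarify
      fix r c r' c'
      assume "(r, c) \<in> cells T" "(r', c') \<in> cells T" "r \<le> r'" "c \<le> c'"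
        and less: "the ((T ! c') r') < the ((T ! c) r)"
      then obtain x y where "(T ! c) r = Some x" "(T ! c') r' = Some y" "c < length T" "c' < length T"
        by (auto simp: cells_def)
      then show False
        using ord[of c c' r x r' y] \<open>r \<le> r'\<close> \<open>c \<le> c'\<close> less by simp
    qed
  qed
qed

lemma spread_mono: "spread P T \<Longrightarrow> (\<And>r x r' y. P r x r' y \<Longrightarrow> Q r x r' y) \<Longrightarrow> spread Q T"
  unfolding spread_def col_compat_def by (auto elim: sorted_wrt_mono_rel[rotated])

lemma spread_Cons: "spread P (c # T) \<longleftrightarrow> (\<forall>d\<in>set (c # T). col_compat P c d) \<and> spread P T"
  by (auto simp: spread_def)

lemma spread_append:
  "spread P (S @ T) \<longleftrightarrow> spread P S \<and> spread P T \<and> (\<forall>c\<in>set S. \<forall>d\<in>set T. col_compat P c d)"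
  by (auto simp: spread_def sorted_wrt_append)

lemma spread_drop_blank: "spread P T \<Longrightarrow> spread P (drop_blank_columns T)"
  by (simp add: spread_def drop_blank_columns_def sorted_wrt_filter)

lemma filling_spread_left: "filling T \<Longrightarrow> spread below_gt T"
  unfolding filling_iff by (auto elim!: spread_mono)

lemma filling_spread_right: "filling T \<Longrightarrow> spread above_lt (rev T)"
  unfolding filling_iff spread_def sorted_wrt_rev col_compat_def
  by (auto elim!: sorted_wrt_mono_rel[rotated])

lemma filling_drop_blank: "filling T \<Longrightarrow> filling (drop_blank_columns T)"
  unfolding filling_iff using spread_drop_blank by (auto simp: drop_blank_columns_def)

lemma sorted_row_word:
  assumes "filling T" shows "sorted (row_word T r)"
proof -
  have "sorted_wrt (col_compat nw_order) T"
    using assms unfolding filling_iff spread_def by blast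
  then show ?thesis
    by (induction T) (auto simp: in_row_word col_compat_def split: option.split)
qed

lemma filling_two_rows: "filling T \<Longrightarrow> filling (two_rows i T)"
  unfolding two_rows_def
proof (rule filling_drop_blank)
  assume f: "filling T"
  have "sorted_wrt (\<lambda>c d. col_compat nw_order (c |` {i, Suc i}) (d |` {i, Suc i})) T"
    using f unfolding filling_iff spread_def
    by (auto simp: col_compat_def restrict_map_def elim!: sorted_wrt_mono_rel[rotated])
  with f show "filling (map (\<lambda>col. col |` {i, Suc i}) T)"
    unfolding filling_iff spread_def
    by (auto simp: col_compat_def restrict_map_def sorted_wrt_map)
qed

lemma row_word_two_rows: "row_word (two_rows i T) r = (if r \<in> {i, Suc i} then row_word T r else [])"
proof -
  have "row_word (map (\<lambda>col. col |` {i, Suc i}) T) r = (if r \<in> {i, Suc i} then row_word T r else [])"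
    by (induction T) (auto split: option.split simp: restrict_map_def)
  then show ?thesis by (simp add: two_rows_def)
qed

text \<open>The first column of the array in which all cells are pushed to the left as far as \<open>P\<close>
  permits. Right justification is the same process for \<open>above_lt\<close> on the reversed array.\<close>

definition first_col :: "(nat \<Rightarrow> nat \<Rightarrow> nat \<Rightarrow> nat \<Rightarrow> bool) \<Rightarrow> (nat \<Rightarrow> nat list) \<Rightarrow> nat \<Rightarrow> nat option" where
  "first_col P R r = (case R r of [] \<Rightarrow> None
     | x # _ \<Rightarrow> if \<forall>r'. \<forall>y\<in>set (R r'). P r x r' y then Some x else None)"

fun packed :: "(nat \<Rightarrow> nat \<Rightarrow> nat \<Rightarrow> nat \<Rightarrow> bool) \<Rightarrow> parray \<Rightarrow> bool" where
  "packed P [] \<longleftrightarrow> True"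
| "packed P (c # T) \<longleftrightarrow> c = first_col P (row_word (c # T)) \<and> packed P T"

lemmas packed_Cons = packed.simps(2)
declare packed.simps(2) [simp del]

lemma packed_tl: "packed P (c # T) \<Longrightarrow> packed P T"
  by (blast dest: packed_Cons[THEN iffD1])

lemma packed_hd: "packed P (c # T) \<Longrightarrow> first_col P (row_word (c # T)) = c"
  by (rule packed_Cons[THEN iffD1, THEN conjunct1, symmetric])

text \<open>\<open>first_col\<close> reads nothing but row words, and blank columns do not
  contribute to them.\<close>

lemma packed_drop_blank: "packed P T \<Longrightarrow> packed P (drop_blank_columns T)"
proof (induction T)
  case (Cons c T)
  have "drop_blank_columns (c # T) = (if c = Map.empty then drop_blank_columns T else c # drop_blank_columns T)"
    by (simp add: drop_blank_columns_def)
  moreover have "row_word (c # drop_blank_columns T) = row_word (c # T)"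
    by (rule ext) (simp split: option.split)
  moreover have "packed P (drop_blank_columns T)"
    using Cons packed_tl by blast
  moreover have "c = first_col P (row_word (c # T))"
    using Cons.prems packed_hd by metis
  ultimately show ?case
    by (metis packed_Cons)
qed (simp add: drop_blank_columns_def)

lemma packed_appendD: "packed P (S @ T) \<Longrightarrow> packed P T"
  by (induction S) (auto dest: packed_tl)

text \<open>The first column is a function of the row words, and removing it determines the row
  words of the rest. Blank columns are dropped since a packed array may end in any number of
  them.\<close>

lemma packed_unique:
  "packed P S \<Longrightarrow> packed P T \<Longrightarrow> row_word S = row_word T \<Longrightarrow> drop_blank_columns S = drop_blank_columns T"
proof (induction S arbitrary: T)
  case Nil
  then have "row_word T r = []" for r by (metis row_word_simps(1))
  then show ?case by (simp add: drop_blank_Nil)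
next
  case (Cons c S)
  show ?case
  proof (cases T)
    case Nil
    then have "row_word (c # S) r = []" for r using Cons.prems(3) by (metis row_word_simps(1))
    then have "drop_blank_columns (c # S) = []" by (rule drop_blank_Nil)
    then show ?thesis using Nil by (simp add: drop_blank_columns_def)
  next
    case (Cons d T')
    have "c = d" using Cons.prems Cons packed_hd by metis
    have "row_word S r = row_word T' r" for r
      using fun_cong[OF Cons.prems(3), of r] \<open>c = d\<close> Cons by (auto split: option.splits)
    then have "drop_blank_columns S = drop_blank_columns T'"
      using Cons.IH[of T'] Cons.prems Cons packed_tl by blast
    then show ?thesis using \<open>c = d\<close> Cons by (simp add: drop_blank_columns_def)
  qed
qed

text \<open>Pushing to the left is optimal: by induction, no prefix of another arrangement contains
  more cells of a row than the packed one.\<close>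

lemma packed_minimal:
  assumes "packed P T" "spread P S" "\<And>r. suffix (row_word T r) (row_word S r)"
  shows "length (drop_blank_columns T) \<le> length S"
  using assms
proof (induction S arbitrary: T)
  case Nil
  then have "row_word T r = []" for r by simp
  then show ?case by (simp add: drop_blank_Nil)
next
  case (Cons c S)
  show ?case
  proof (cases T)
    case (Cons d T')
    have "suffix (row_word T' r) (row_word S r)" for r
    proof (cases "c r")
      case None
      have "suffix (row_word T' r) (row_word T r)"
        using \<open>T = d # T'\<close> by (auto split: option.split simp: suffix_ConsI)
      then show ?thesis
        using Cons.prems(3)[of r] None suffix_order.trans by simp
    next
      case (Some x)
      show ?thesis
      proof (cases "row_word T r = row_word (c # S) r")
        case False
        then have "suffix (row_word T r) (row_word S r)"
          using Cons.prems(3)[of r] Some by (auto simp: suffix_Cons)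
        then show ?thesis
          using \<open>T = d # T'\<close> suffix_order.trans by (auto split: option.splits simp: suffix_ConsI dest: suffix_ConsD)
      next
        case True
        \<comment> \<open>Row r is equally far advanced in both arrays, so both have the head x. All
          entries still present in \<open>T\<close> are still present in \<open>c # S\<close>, where
          x coexists with them; so nothing keeps x out of the packed column.\<close>
        have "P r x r' y" if "y \<in> set (row_word T r')" for r' y
        proof -
          have "y \<in> set (row_word (c # S) r')" using that Cons.prems(3)[of r'] set_mono_suffix by blast
          then show ?thesis
            using Cons.prems(2) Some unfolding in_row_word spread_Cons col_compat_def by blast
        qed
        moreover have "d r = first_col P (row_word T) r"
          using Cons.prems(1) \<open>T = d # T'\<close> packed_hd by metis
        ultimately have "d r = Some x"
          using True Some by (auto simp: first_col_def)
        then show ?thesis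
          using True Some \<open>T = d # T'\<close> by simp
      qed
    qed
    then have "length (drop_blank_columns T') \<le> length S"
      using Cons.IH[of T'] Cons.prems Cons packed_tl spread_Cons by blast
    then show ?thesis using Cons by (simp add: drop_blank_columns_def)
  qed (simp add: drop_blank_columns_def)
qed

definition tight :: "(nat \<Rightarrow> nat \<Rightarrow> nat \<Rightarrow> nat \<Rightarrow> bool) \<Rightarrow> (nat \<Rightarrow> nat option) \<Rightarrow> (nat \<Rightarrow> nat option) \<Rightarrow> bool" where
  "tight P c d \<longleftrightarrow> (\<forall>r x. d r = Some x \<longrightarrow> c r = None \<longrightarrow> (\<exists>r' y. c r' = Some y \<and> \<not> P r x r' y))"

text \<open>Turns the local condition into the global one tested by \<open>first_col\<close>. The
  first cell of row r may lie far to the right of the blank in c; the column just before it is also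
  blank in row r, and tightness there supplies a blocking cell somewhere in the array.\<close>

lemma tight_blocked:
  assumes "successively (tight P) (c # T)" "c r = None" "row_word T r = x # xs"
  shows "\<exists>r'. \<exists>y\<in>set (row_word (c # T) r'). \<not> P r x r' y"
  using assms
proof (induction T arbitrary: c)
  case (Cons d T)
  show ?case
  proof (cases "d r")
    case None
    then obtain r' y where "y \<in> set (row_word (d # T) r')" "\<not> P r x r' y"
      using Cons.IH[of d] Cons.prems by auto
    then show ?thesis by (metis in_row_word list.set_intros(2))
  next
    case (Some z)
    then have "z = x" using Cons.prems(3) by simp
    then obtain r' y where "c r' = Some y" "\<not> P r x r' y"
      using Cons.prems(1,2) Some unfolding successively.simps tight_def by blast
    then show ?thesis by (metis in_row_word list.set_intros(1))
  qed
qed simp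

text \<open>A cell of the first column coexists with everything later, so \<open>first_col\<close>
  admits it; a blank whose row still has cells is blocked by \<open>tight_blocked\<close>.\<close>

lemma tight_packed:
  assumes "successively (tight P) T" "spread P T"
  shows "packed P T"
  using assms
proof (induction T)
  case (Cons c T)
  have "c r = first_col P (row_word (c # T)) r" for r
  proof (cases "c r")
    case (Some x)
    have "P r x r' y" if y: "y \<in> set (row_word (c # T) r')" for r' y
    proof -
      obtain d where "d \<in> set (c # T)" "d r' = Some y"
        using y unfolding in_row_word by blast
      then have "col_compat P c d"
        using Cons.prems(2) unfolding spread_Cons by blast
      then show ?thesis
        using Some \<open>d r' = Some y\<close> unfolding col_compat_def by blast
    qed
    moreover have "row_word (c # T) r = x # row_word T r" using Some by simp
    ultimately have "first_col P (row_word (c # T)) r = Some x"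
      unfolding first_col_def by (simp del: row_word_simps)
    then show ?thesis using Some by simp
  next
    case None
    show ?thesis
    proof (cases "row_word T r")
      case (Cons x xs)
      from tight_blocked[OF Cons.prems(1) None Cons] None Cons
      have "first_col P (row_word (c # T)) r = None" unfolding first_col_def by auto
      then show ?thesis using None by simp
    qed (use None in \<open>simp add: first_col_def\<close>)
  qed
  moreover have "packed P T"
    using Cons by (cases T) (auto simp: spread_Cons)
  ultimately show ?case unfolding packed_Cons by blast
qed simp

section \<open>Justified forms\<close>

lemma col_compat_update_right:
  "col_compat P e c \<Longrightarrow> (\<And>r' y x. v = Some x \<Longrightarrow> e r' = Some y \<Longrightarrow> P r' y r x) \<Longrightarrow> col_compat P e (c(r := v))"
  by (simp add: col_compat_def)

lemma col_compat_update_left: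
  "col_compat P c e \<Longrightarrow> (\<And>r' y x. v = Some x \<Longrightarrow> e r' = Some y \<Longrightarrow> P r x r' y) \<Longrightarrow> col_compat P (c(r := v)) e"
  by (simp add: col_compat_def)

lemma col_compatD: "col_compat P c d \<Longrightarrow> c r = Some x \<Longrightarrow> d r' = Some y \<Longrightarrow> P r x r' y"
  by (simp add: col_compat_def)

lemma swap_split: "Suc k < length T \<Longrightarrow> \<exists>X c d Y. T = X @ c # d # Y \<and> length X = k"
  by (rule exI[of _ "take k T"], rule exI[of _ "T ! k"], rule exI[of _ "T ! Suc k"],
      rule exI[of _ "drop (Suc (Suc k)) T"]) (simp add: Cons_nth_drop_Suc)

lemma left_swap_iff:
  "left_swap T S \<longleftrightarrow> (\<exists>X c d Y r x. T = X @ c # d # Y \<and> c r = None \<and> d r = Some x \<and>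
     S = X @ c(r := Some x) # d(r := None) # Y \<and> filling S)" (is "_ \<longleftrightarrow> ?R")
proof
  assume "left_swap T S"
  then obtain r k where k: "(r, Suc k) \<in> cells T" "(r, k) \<notin> cells T"
    "S = move_cell r (Suc k) k T" "filling S"
    by (auto simp: left_swap_def)
  then have "Suc k < length T" by (simp add: cells_def)
  then obtain X c d Y where "T = X @ c # d # Y" "length X = k" using swap_split by blast
  with k obtain x where "c r = None" "d r = Some x" "S = X @ c(r := Some x) # d(r := None) # Y"
    by (auto simp: cells_def move_cell_def nth_append list_update_append)
  then show ?R using \<open>T = X @ c # d # Y\<close> k(4) by blast
next
  assume ?R
  then obtain X c d Y r x where h: "T = X @ c # d # Y" "c r = None" "d r = Some x"
     "S = X @ c(r := Some x) # d(r := None) # Y" "filling S" by blast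
  have "(r, Suc (length X)) \<in> cells T" "(r, length X) \<notin> cells T"
    "S = move_cell r (Suc (length X)) (length X) T"
    using h by (auto simp: cells_def move_cell_def nth_append list_update_append)
  then show "left_swap T S" using h(5) unfolding left_swap_def by blast
qed

lemma right_swap_iff:
  "right_swap T S \<longleftrightarrow> (\<exists>X c d Y r x. T = X @ c # d # Y \<and> c r = Some x \<and> d r = None \<and>
     S = X @ c(r := None) # d(r := Some x) # Y \<and> filling S)" (is "_ \<longleftrightarrow> ?R")
proof
  assume "right_swap T S"
  then obtain r k where k: "(r, k) \<in> cells T" "(r, Suc k) \<notin> cells T" "Suc k < length T"
    "S = move_cell r k (Suc k) T" "filling S"
    by (auto simp: right_swap_def)
  then obtain X c d Y where "T = X @ c # d # Y" "length X = k" using swap_split by blast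
  with k obtain x where "c r = Some x" "d r = None" "S = X @ c(r := None) # d(r := Some x) # Y"
    by (auto simp: cells_def move_cell_def nth_append list_update_append)
  then show ?R using \<open>T = X @ c # d # Y\<close> k(5) by blast
next
  assume ?R
  then obtain X c d Y r x where h: "T = X @ c # d # Y" "c r = Some x" "d r = None"
     "S = X @ c(r := None) # d(r := Some x) # Y" "filling S" by blast
  have "(r, length X) \<in> cells T" "(r, Suc (length X)) \<notin> cells T" "Suc (length X) < length T"
    "S = move_cell r (length X) (Suc (length X)) T"
    using h by (auto simp: cells_def move_cell_def nth_append list_update_append)
  then show "right_swap T S" using h(5) unfolding right_swap_def by blast
qed

lemma swap_invariants:
  assumes "left_swap T S \<or> right_swap T S"
  shows "filling S \<and> length S = length T \<and> row_word S = row_word T"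
proof -
  consider (l) X c d Y r x where "T = X @ c # d # Y" "c r = None" "d r = Some x"
      "S = X @ c(r := Some x) # d(r := None) # Y" "filling S"
    | (r) X c d Y r x where "T = X @ c # d # Y" "c r = Some x" "d r = None"
      "S = X @ c(r := None) # d(r := Some x) # Y" "filling S"
    using assms unfolding left_swap_iff right_swap_iff by blast
  then show ?thesis
  proof cases
    case l
    then have "row_word S q = row_word T q" for q by (auto split: option.split)
    with l show ?thesis by auto
  next
    case r
    then have "row_word S q = row_word T q" for q by (auto split: option.split)
    with r show ?thesis by auto
  qed
qed

lemma swaps_invariants:
  assumes "(\<lambda>T S. left_swap T S \<or> right_swap T S)\<^sup>*\<^sup>* T S"
  shows "(filling T \<longrightarrow> filling S) \<and> length S = length T \<and> row_word S = row_word T"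
  using assms
proof induction
  case (step S S')
  then show ?case using swap_invariants[of S S'] by auto
qed simp

section \<open>Termination of left and right swaps\<close>

lemma finite_dom_columns:
  "(\<forall>c\<in>set T. finite (dom c)) \<longleftrightarrow> finite {r. row_word T r \<noteq> []}"
proof -
  have "{r. row_word T r \<noteq> []} = (\<Union>c\<in>set T. dom c)"
    by (auto simp: row_word_eq_Nil)
  then show ?thesis by simp
qed

text \<open>The sum of the column numbers of all cells: a cell is counted once for every column to
  its left. A left swap lowers it; right swaps are measured on the reversed array.\<close>

fun cell_weight :: "parray \<Rightarrow> nat" where
  "cell_weight [] = 0"
| "cell_weight (c # T) = cell_weight T + sum_list (map (\<lambda>d. card (dom d)) T)"

lemma cell_weight_swap:
  assumes "c r = None" "d r = Some x" "finite (dom c)" "finite (dom d)"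
  shows "cell_weight (X @ c(r := Some x) # d(r := None) # Y) < cell_weight (X @ c # d # Y)"
proof -
  have c: "card (dom (c(r := Some x))) = Suc (card (dom c))"
    using assms by (simp add: card_insert_if domIff)
  have d: "card (dom d) = Suc (card (dom (d(r := None))))"
    using assms card_Suc_Diff1[of "dom d" r] by (simp add: domIff)
  have "cell_weight (X @ c' # d' # Y) < cell_weight (X @ c # d # Y)"
    if "card (dom c') = Suc (card (dom c))" "card (dom d) = Suc (card (dom d'))" for c' d'
    by (induction X) (simp_all add: that)
  from this[OF c d] show ?thesis .
qed

lemma ex_terminal:
  assumes "\<And>S S'. I S \<Longrightarrow> R S S' \<Longrightarrow> I S' \<and> m S' < (m S :: nat)" "I T"
  shows "\<exists>S. R\<^sup>*\<^sup>* T S \<and> (\<nexists>S'. R S S')"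
  using assms(2)
proof (induction "m T" arbitrary: T rule: less_induct)
  case less
  show ?case
  proof (cases "\<exists>S'. R T S'")
    case True
    then obtain S' where "R T S'" by blast
    then show ?thesis
      using less assms(1) converse_rtranclp_into_rtranclp[of R T S'] by metis
  qed blast
qed

text \<open>Columns are functions on all of nat, and \<open>card\<close> is 0 on an infinite domain,
  so the measure works only for finite columns. Expressed through row words, that condition is
  preserved by swaps.\<close>

lemma ex_left_justified:
  assumes "finite {r. row_word T r \<noteq> []}"
  shows "\<exists>S. left_swap\<^sup>*\<^sup>* T S \<and> (\<nexists>S'. left_swap S S')"
proof (rule ex_terminal[where I = "\<lambda>S. finite {r. row_word S r \<noteq> []}" and m = cell_weight])
  fix S S' assume I: "finite {r. row_word S r \<noteq> []}" and s: "left_swap S S'"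
  then obtain X c d Y r x where "S = X @ c # d # Y" "c r = None" "d r = Some x"
     "S' = X @ c(r := Some x) # d(r := None) # Y" unfolding left_swap_iff by blast
  moreover from this have "finite (dom c)" "finite (dom d)"
    using I[folded finite_dom_columns] by auto
  ultimately have "cell_weight S' < cell_weight S"
    using cell_weight_swap by metis
  then show "finite {r. row_word S' r \<noteq> []} \<and> cell_weight S' < cell_weight S"
    using I swap_invariants s by metis
qed fact

lemma ex_right_justified:
  assumes "finite {r. row_word T r \<noteq> []}"
  shows "\<exists>S. right_swap\<^sup>*\<^sup>* T S \<and> (\<nexists>S'. right_swap S S')"
proof (rule ex_terminal[where I = "\<lambda>S. finite {r. row_word S r \<noteq> []}" and m = "\<lambda>S. cell_weight (rev S)"])
  fix S S' assume I: "finite {r. row_word S r \<noteq> []}" and s: "right_swap S S'"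
  then obtain X c d Y r x where "S = X @ c # d # Y" "d r = None" "c r = Some x"
     "S' = X @ c(r := None) # d(r := Some x) # Y" unfolding right_swap_iff by blast
  moreover from this have "finite (dom c)" "finite (dom d)"
    using I[folded finite_dom_columns] by auto
  ultimately have "cell_weight (rev S') < cell_weight (rev S)"
    using cell_weight_swap[of d r c x "rev Y" "rev X"] by simp
  then show "finite {r. row_word S' r \<noteq> []} \<and> cell_weight (rev S') < cell_weight (rev S)"
    using I swap_invariants s by metis
qed fact

section \<open>Arrays that admit no further swap\<close>

lemma successively_split:
  "(\<And>X c d Y. T = X @ c # d # Y \<Longrightarrow> P c d) \<Longrightarrow> successively P T"
proof (induction P T rule: successively.induct)
  case (3 P c d T)
  have "P c d" using "3.prems"[of "[]" c d T] by simp
  moreover have "successively P (d # T)"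
    using "3.prems" by (intro "3.IH") (metis append_Cons)
  ultimately show ?case by simp
qed auto

text \<open>If no cell of c below row r blocked x, the swap would be admissible: the relations to
  columns outside c and d are inherited from those of c and d, and the cells of c above row r are
  smaller than x because x stood to their right.\<close>

lemma no_left_swap_tight:
  assumes f: "filling T" and no: "\<nexists>S. left_swap T S"
  shows "successively (tight below_gt) T"
proof (rule successively_split)
  fix X c d Y assume T: "T = X @ c # d # Y"
  show "tight below_gt c d"
    unfolding tight_def
  proof (intro allI impI, rule ccontr)
    fix r x assume d: "d r = Some x" and c: "c r = None"
      and "\<not> (\<exists>r' y. c r' = Some y \<and> \<not> (r < r' \<longrightarrow> x < y))"
    then have gt: "\<And>r' y. c r' = Some y \<Longrightarrow> r < r' \<Longrightarrow> x < y" by blast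
    \<comment> \<open>c is blank in row r, so the strict and the weak comparison with r agree on its
      cells.\<close>
    have gt': "\<And>r' y. c r' = Some y \<Longrightarrow> r \<le> r' \<Longrightarrow> x < y"
      using gt c by (metis le_neq_implies_less option.distinct(1))
    have co: "col_compat nw_order c c" "col_compat nw_order d d" "col_compat nw_order c d"
      "\<And>e. e \<in> set X \<Longrightarrow> col_compat nw_order e c" "\<And>e. e \<in> set X \<Longrightarrow> col_compat nw_order e d"
      "\<And>e. e \<in> set Y \<Longrightarrow> col_compat nw_order c e" "\<And>e. e \<in> set Y \<Longrightarrow> col_compat nw_order d e"
      using f unfolding T filling_iff spread_append spread_Cons by auto
    let ?c = "c(r := Some x)" and ?d = "d(r := None)"
    have "col_compat nw_order e ?c" "col_compat nw_order e ?d" if "e \<in> set X" for e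
      using co(4,5)[OF that] col_compatD[OF co(5)[OF that] _ d]
      by (auto intro!: col_compat_update_right)
    moreover have "col_compat nw_order ?c e" "col_compat nw_order ?d e" if "e \<in> set Y" for e
      using co(6,7)[OF that] col_compatD[OF co(7)[OF that] d]
      by (auto intro!: col_compat_update_left)
    moreover have "col_compat nw_order ?c ?c"
      using co(1) col_compatD[OF co(3) _ d] gt'
      by (intro col_compat_update_left col_compat_update_right) (auto simp: less_imp_le split: if_splits)
    moreover have "col_compat nw_order ?d ?d"
      using co(2) by (auto intro!: col_compat_update_left col_compat_update_right)
    moreover have "col_compat nw_order ?c ?d"
      using co(3) col_compatD[OF co(2) d] 
      by (intro col_compat_update_left col_compat_update_right) (auto split: if_splits)
    ultimately have "spread nw_order (X @ ?c # ?d # Y)"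
      using f unfolding T filling_iff spread_append spread_Cons by auto
    moreover have "\<forall>e\<in>set (X @ ?c # ?d # Y). \<forall>q z. e q = Some z \<longrightarrow> 1 \<le> q \<and> 1 \<le> z"
    proof -
      have "\<forall>e\<in>set T. \<forall>q z. e q = Some z \<longrightarrow> 1 \<le> q \<and> 1 \<le> z" using f filling_iff by blast
      then show ?thesis using d unfolding T by (auto split: if_splits)
    qed
    ultimately have "filling (X @ ?c # ?d # Y)" unfolding filling_iff by blast
    then have "left_swap T (X @ ?c # ?d # Y)" unfolding left_swap_iff using T c d by blast
    then show False using no by blast
  qed
qed

text \<open>The mirror image: a move to the right can be blocked only by a cell above.\<close>

lemma no_right_swap_tight:
  assumes f: "filling T" and no: "\<nexists>S. right_swap T S"
  shows "successively (tight above_lt) (rev T)"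
  unfolding successively_rev
proof (rule successively_split)
  fix X c d Y assume T: "T = X @ c # d # Y"
  show "tight above_lt d c"
    unfolding tight_def
  proof (intro allI impI, rule ccontr)
    fix r x assume c: "c r = Some x" and d: "d r = None"
      and "\<not> (\<exists>r' y. d r' = Some y \<and> \<not> (r' < r \<longrightarrow> y < x))"
    then have gt: "\<And>r' y. d r' = Some y \<Longrightarrow> r' < r \<Longrightarrow> y < x" by blast
    have gt': "\<And>r' y. d r' = Some y \<Longrightarrow> r' \<le> r \<Longrightarrow> y < x"
      using gt d by (metis le_neq_implies_less option.distinct(1))
    have co: "col_compat nw_order c c" "col_compat nw_order d d" "col_compat nw_order c d"
      "\<And>e. e \<in> set X \<Longrightarrow> col_compat nw_order e c" "\<And>e. e \<in> set X \<Longrightarrow> col_compat nw_order e d"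
      "\<And>e. e \<in> set Y \<Longrightarrow> col_compat nw_order c e" "\<And>e. e \<in> set Y \<Longrightarrow> col_compat nw_order d e"
      using f unfolding T filling_iff spread_append spread_Cons by auto
    let ?c = "c(r := None)" and ?d = "d(r := Some x)"
    have "col_compat nw_order e ?c" "col_compat nw_order e ?d" if "e \<in> set X" for e
      using co(4,5)[OF that] col_compatD[OF co(4)[OF that] _ c]
      by (auto intro!: col_compat_update_right)
    moreover have "col_compat nw_order ?c e" "col_compat nw_order ?d e" if "e \<in> set Y" for e
      using co(6,7)[OF that] col_compatD[OF co(6)[OF that] c]
      by (auto intro!: col_compat_update_left)
    moreover have "col_compat nw_order ?d ?d"
      using co(2) col_compatD[OF co(3) c] gt'
      by (intro col_compat_update_left col_compat_update_right) (auto simp: less_imp_le split: if_splits)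
    moreover have "col_compat nw_order ?c ?c"
      using co(1) by (auto intro!: col_compat_update_left col_compat_update_right)
    moreover have "col_compat nw_order ?c ?d"
      using co(3) col_compatD[OF co(1) _ c]
      by (intro col_compat_update_left col_compat_update_right) (auto split: if_splits)
    ultimately have "spread nw_order (X @ ?c # ?d # Y)"
      using f unfolding T filling_iff spread_append spread_Cons by auto
    moreover have "\<forall>e\<in>set (X @ ?c # ?d # Y). \<forall>q z. e q = Some z \<longrightarrow> 1 \<le> q \<and> 1 \<le> z"
    proof -
      have "\<forall>e\<in>set T. \<forall>q z. e q = Some z \<longrightarrow> 1 \<le> q \<and> 1 \<le> z" using f filling_iff by blast
      then show ?thesis using c unfolding T by (auto split: if_splits)
    qed
    ultimately have "filling (X @ ?c # ?d # Y)" unfolding filling_iff by blast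
    then have "right_swap T (X @ ?c # ?d # Y)" unfolding right_swap_iff using T c d by blast
    then show False using no by blast
  qed
qed

text \<open>Whichever terminal array the choice operator picks, it is tight and hence packed. Later
  proofs know the left-justified form only through these four facts.\<close>

lemma left_justified_props:
  assumes f: "filling T" and fin: "finite {r. row_word T r \<noteq> []}"
  shows "filling (left_justified T)" "row_word (left_justified T) = row_word T"
    "Map.empty \<notin> set (left_justified T)" "packed below_gt (left_justified T)"
proof -
  define S where "S = (SOME S. left_swap\<^sup>*\<^sup>* T S \<and> (\<nexists>S'. left_swap S S'))"
  have lj: "left_justified T = drop_blank_columns S" by (simp add: left_justified_def S_def)
  have S: "left_swap\<^sup>*\<^sup>* T S" "\<nexists>S'. left_swap S S'"
    using someI_ex[OF ex_left_justified[OF fin]] unfolding S_def by blast+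
  from S(1) have "(\<lambda>T S. left_swap T S \<or> right_swap T S)\<^sup>*\<^sup>* T S"
    by (rule rtranclp_mono[THEN predicate2D, rotated]) auto
  from swaps_invariants[OF this] f have S': "filling S" "row_word S = row_word T" by auto
  then show "filling (left_justified T)" "row_word (left_justified T) = row_word T"
    unfolding lj by (auto intro: filling_drop_blank)
  show "Map.empty \<notin> set (left_justified T)" unfolding lj by (rule drop_blank_no_blank)
  show "packed below_gt (left_justified T)"
    unfolding lj
    using tight_packed[OF no_left_swap_tight filling_spread_left] S' S(2) packed_drop_blank by metis
qed

lemma right_justified_props:
  assumes f: "filling T" and fin: "finite {r. row_word T r \<noteq> []}"
  shows "filling (right_justified T)" "row_word (right_justified T) = row_word T"
    "Map.empty \<notin> set (right_justified T)" "packed above_lt (rev (right_justified T))"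
proof -
  define S where "S = (SOME S. right_swap\<^sup>*\<^sup>* T S \<and> (\<nexists>S'. right_swap S S'))"
  have rj: "right_justified T = drop_blank_columns S" by (simp add: right_justified_def S_def)
  have S: "right_swap\<^sup>*\<^sup>* T S" "\<nexists>S'. right_swap S S'"
    using someI_ex[OF ex_right_justified[OF fin]] unfolding S_def by blast+
  from S(1) have "(\<lambda>T S. left_swap T S \<or> right_swap T S)\<^sup>*\<^sup>* T S"
    by (rule rtranclp_mono[THEN predicate2D, rotated]) auto
  from swaps_invariants[OF this] f have S': "filling S" "row_word S = row_word T" by auto
  then show "filling (right_justified T)" "row_word (right_justified T) = row_word T"
    unfolding rj by (auto intro: filling_drop_blank)
  show "Map.empty \<notin> set (right_justified T)" unfolding rj by (rule drop_blank_no_blank)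
  have "packed above_lt (drop_blank_columns (rev S))"
    using tight_packed[OF no_right_swap_tight filling_spread_right] S' S(2) packed_drop_blank by metis
  then show "packed above_lt (rev (right_justified T))"
    unfolding rj by (simp add: drop_blank_columns_def rev_filter)
qed

text \<open>The way to compute justified forms from here on: exhibit any packed array without blank
  columns that has the right row words.\<close>

lemma left_justified_eqI:
  assumes "filling T" "finite {r. row_word T r \<noteq> []}"
    and "packed below_gt S" "Map.empty \<notin> set S" "row_word S = row_word T"
  shows "left_justified T = S"
  using packed_unique[OF left_justified_props(4)[OF assms(1,2)] assms(3)]
    left_justified_props[OF assms(1,2)] assms by (simp add: drop_blank_eq)

lemma length_left_justified_le:
  assumes "filling T" "finite {r. row_word T r \<noteq> []}" "filling S" "row_word S = row_word T"
  shows "length (left_justified T) \<le> length S"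
  using packed_minimal[OF left_justified_props(4)[OF assms(1,2)] filling_spread_left[OF assms(3)]]
    left_justified_props[OF assms(1,2)] assms by (simp add: drop_blank_eq)

lemma length_right_justified_le:
  assumes "filling T" "finite {r. row_word T r \<noteq> []}" "filling S" "row_word S = row_word T"
  shows "length (right_justified T) \<le> length S"
proof -
  have rev: "row_word (rev S) r = rev (row_word S r)" for S r
    by (simp add: row_word_def rev_map rev_filter)
  show ?thesis
    using packed_minimal[OF right_justified_props(4)[OF assms(1,2)] filling_spread_right[OF assms(3)]]
      right_justified_props[OF assms(1,2)] assms by (simp add: drop_blank_eq rev)
qed

text \<open>Left- and right-justified forms both attain the least number of columns among the
  fillings with the given row words, so they have equally many. In the right-justified form each
  column contributes either a cell or a blank to row i+1.\<close>

lemma phi_eq: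
  assumes f: "filling T"
  shows "phi i T + length (row_word T (Suc i)) = length (left_justified (two_rows i T))"
proof -
  let ?T = "two_rows i T"
  let ?S = "right_justified ?T"
  have T: "filling ?T" using f by (rule filling_two_rows)
  have "{r. row_word ?T r \<noteq> []} \<subseteq> {i, Suc i}" by (auto simp: row_word_two_rows)
  then have fin: "finite {r. row_word ?T r \<noteq> []}" by (rule finite_subset) simp
  note R = right_justified_props[OF T fin] and L = left_justified_props[OF T fin]
  have "phi i T = card {c. c < length ?S \<and> (?S ! c) (Suc i) = None}"
    unfolding phi_def Let_def by (rule arg_cong[of _ _ card]) (auto simp: cells_def)
  also have "\<dots> = length (filter (\<lambda>c. c (Suc i) = None) ?S)"
    by (simp add: length_filter_conv_card)
  finally have "phi i T = \<dots>" .
  moreover have "length (row_word T (Suc i)) = length (filter (\<lambda>c. c (Suc i) \<noteq> None) ?S)"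
    using R(2) row_word_two_rows[of i T "Suc i"] length_row_word[of ?S "Suc i"] by simp
  ultimately have "phi i T + length (row_word T (Suc i)) = length ?S"
    using sum_length_filter_compl[of "\<lambda>c. c (Suc i) = None" ?S] by simp
  moreover have "length ?S = length (left_justified ?T)"
    using length_left_justified_le[OF T fin R(1,2)] length_right_justified_le[OF T fin L(1,2)] by simp
  ultimately show ?thesis by simp
qed

section \<open>Two rows\<close>

lemma finite_two_rows: "finite {r. row_word (two_rows i T) r \<noteq> []}"
  by (rule finite_subset[of _ "{i, Suc i}"]) (auto simp: row_word_two_rows)

abbreviation left_rows :: "nat \<Rightarrow> parray \<Rightarrow> parray" where
  "left_rows i T \<equiv> left_justified (two_rows i T)"

lemmas left_rows_props = left_justified_props[OF filling_two_rows finite_two_rows]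

lemma left_rows_eqI:
  assumes "filling T" "packed below_gt S" "Map.empty \<notin> set S"
    and "\<And>r. row_word S r = (if r \<in> {i, Suc i} then row_word T r else [])"
  shows "left_rows i T = S"
proof (rule left_justified_eqI)
  show "row_word S = row_word (two_rows i T)"
    using assms(4) row_word_two_rows by (intro ext) metis
qed (use assms in \<open>auto intro: filling_two_rows finite_two_rows\<close>)

lemma left_rows_cong:
  assumes "filling T" "filling T'" "row_word T i = row_word T' i" "row_word T (Suc i) = row_word T' (Suc i)"
  shows "left_rows i T = left_rows i T'"
proof (rule left_rows_eqI)
  show "row_word (left_rows i T') r = (if r \<in> {i, Suc i} then row_word T r else [])" for r
    using left_rows_props(2)[OF assms(2)] assms(3,4) by (auto simp: row_word_two_rows)
qed (use left_rows_props[OF assms(2)] assms(1) in auto)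

definition two_rowed :: "nat \<Rightarrow> parray \<Rightarrow> bool" where
  "two_rowed i S \<longleftrightarrow> (\<forall>c\<in>set S. dom c \<subseteq> {i, Suc i} \<and> c \<noteq> Map.empty)"

lemma two_rowed_left_rows:
  assumes "filling T" shows "two_rowed i (left_rows i T)"
proof -
  have "row_word (left_rows i T) r = []" if "r \<notin> {i, Suc i}" for r
    using left_rows_props(2)[OF assms] that by (simp add: row_word_two_rows)
  then show ?thesis
    unfolding two_rowed_def row_word_eq_Nil using left_rows_props(3)[OF assms] by (fastforce simp: dom_def)
qed

lemma two_rowed_other: "two_rowed i S \<Longrightarrow> r \<noteq> i \<Longrightarrow> r \<noteq> Suc i \<Longrightarrow> row_word S r = []"
  unfolding two_rowed_def row_word_eq_Nil by (metis domI insertE not_Some_eq singletonD subsetD)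

lemma two_rowed_column: "two_rowed i S \<Longrightarrow> c \<in> set S \<Longrightarrow> c (Suc i) = None \<Longrightarrow> c i \<noteq> None"
  unfolding two_rowed_def by (auto simp: fun_eq_iff dom_def) (metis (mono_tags, lifting) insertE mem_Collect_eq not_Some_eq singletonD subsetD)

text \<open>The row \<open>i+1\<close> is never pushed back by the row \<open>i\<close>.\<close>

lemma two_rowed_split:
  "packed below_gt S \<Longrightarrow> two_rowed i S \<Longrightarrow> \<exists>S1 S2. S = S1 @ S2 \<and>
     (\<forall>c\<in>set S1. c (Suc i) \<noteq> None) \<and> (\<forall>c\<in>set S2. c (Suc i) = None)"
proof (induction S)
  case (Cons c S)
  then obtain S1 S2 where S: "S = S1 @ S2" "\<forall>c\<in>set S1. c (Suc i) \<noteq> None" "\<forall>c\<in>set S2. c (Suc i) = None"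
    using packed_tl[OF Cons.prems(1)] by (auto simp: two_rowed_def)
  show ?case
  proof (cases "c (Suc i)")
    case None
    \<comment> \<open>A blank in row i+1 means that this row is exhausted, since its head would have
      entered the column.\<close>
    have "row_word (c # S) (Suc i) = []"
    proof (cases "row_word (c # S) (Suc i)")
      case (Cons x xs)
      have "below_gt (Suc i) x r' y" if "y \<in> set (row_word (c # S) r')" for r' y
        using two_rowed_other[OF Cons.prems(2), of r'] that by fastforce
      then have "first_col below_gt (row_word (c # S)) (Suc i) = Some x"
        unfolding first_col_def Cons by simp
      then show ?thesis using packed_hd[OF Cons.prems(1)] None by simp
    qed
    then have "\<forall>d\<in>set (c # S). d (Suc i) = None" by (simp only: row_word_eq_Nil)
    then show ?thesis by (intro exI[of _ "[]"] exI[of _ "c # S"]) simp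
  next
    case (Some x)
    then show ?thesis using S by (intro exI[of _ "c # S1"] exI[of _ S2]) simp
  qed
qed simp

section \<open>A last cell adjoined to two justified rows\<close>

lemma packed_ConsI:
  "packed P T \<Longrightarrow> (\<And>r. c r = first_col P (row_word (c # T)) r) \<Longrightarrow> packed P (c # T)"
  unfolding packed_Cons by blast

text \<open>A column with a blank in row i holds a cell of row i+1, whose entry is at most s and so
  blocks s; hence s needs a column of its own. The other cells keep their places because only cells
  below can block.\<close>

lemma packed_append_upper:
  assumes "packed below_gt S" "two_rowed i S" "\<forall>y\<in>set (row_word S (Suc i)). y \<le> s"
  shows "packed below_gt (S @ [[i \<mapsto> s]])"
  using assms
proof (induction S)
  case Nil
  show ?case by (rule append_Nil[THEN ssubst], rule packed_ConsI) (auto simp: first_col_def)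
next
  case (Cons c S)
  let ?R = "row_word (c # S)" and ?R' = "row_word (c # S @ [[i \<mapsto> s]])"
  have R': "?R' r = (if r = i then ?R r @ [s] else ?R r)" for r
    by (auto split: option.split)
  have other: "\<And>r. r \<noteq> i \<Longrightarrow> r \<noteq> Suc i \<Longrightarrow> ?R r = []"
    using two_rowed_other[OF Cons.prems(2)] by blast
  have "packed below_gt (S @ [[i \<mapsto> s]])"
    using Cons.prems packed_tl[OF Cons.prems(1)]
    by (intro Cons.IH) (auto simp: two_rowed_def split: option.splits)
  moreover have "c r = first_col below_gt ?R' r" for r
  proof -
    have c: "c r = first_col below_gt ?R r" using packed_hd[OF Cons.prems(1)] by simp
    consider "r = i" "?R i = []" | x xs where "r = i" "?R i = x # xs" | "r \<noteq> i" by (cases "?R i") auto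
    then show ?thesis
    proof cases
      case 1
      then have "c i = None" by (simp add: row_word_eq_Nil del: row_word_simps)
      then obtain y where "c (Suc i) = Some y" using two_rowed_column[OF Cons.prems(2), of c] by auto
      then have "y \<in> set (?R' (Suc i))" "y \<le> s" using R' Cons.prems(3) by auto
      then have "first_col below_gt ?R' r = None"
        unfolding first_col_def using 1 R'[of i] by (auto simp del: row_word_simps intro!: exI[of _ "Suc i"] bexI[of _ y])
      then show ?thesis using 1 \<open>c i = None\<close> by simp
    next
      case (2 x xs)
      then show ?thesis
        unfolding c first_col_def R' by (auto simp del: row_word_simps)
    next
      case 3
      then show ?thesis
        unfolding c first_col_def R' by (auto simp del: row_word_simps simp: other split: list.split)
    qed
  qed
  ultimately show ?case unfolding append_Cons by (rule packed_ConsI)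
qed

text \<open>Since s exceeds all of row i, its arrival in row i+1 blocks nothing, and it alters the
  head of row i+1 only if that row was empty. So the first column can change only in the case
  excluded by the last assumption.\<close>

lemma first_col_append_lower:
  assumes other: "\<And>r. r \<noteq> i \<Longrightarrow> r \<noteq> Suc i \<Longrightarrow> R r = []"
    and R': "\<And>r. R' r = (if r = Suc i then R r @ [s] else R r)"
    and less: "\<forall>x\<in>set (R i). x < s"
    and "r \<noteq> Suc i \<or> R (Suc i) \<noteq> []"
  shows "first_col below_gt R' r = first_col below_gt R r"
proof (cases "R r")
  case Nil
  then show ?thesis using R' assms(4) by (auto simp: first_col_def)
next
  case (Cons x xs)
  have "(\<forall>r'. \<forall>y\<in>set (R' r'). below_gt r x r' y) \<longleftrightarrow> (\<forall>r'. \<forall>y\<in>set (R r'). below_gt r x r' y)"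
  proof (cases "r = i")
    case True
    then show ?thesis using less Cons R' by auto
  next
    case False
    then have "r = Suc i" using other Cons by (metis list.distinct(1))
    then show ?thesis using R' by auto
  qed
  moreover obtain zs where "R' r = x # zs" using R'[of r] Cons by (cases "r = Suc i") auto
  ultimately show ?thesis unfolding first_col_def Cons by simp
qed

text \<open>Each column consumes a cell of row i+1, so s comes to the front only after the last of
  them.\<close>

lemma packed_append_lower:
  assumes "packed below_gt S" "two_rowed i S" "\<forall>c\<in>set S. c (Suc i) \<noteq> None"
    "\<forall>x\<in>set (row_word S i). x < s"
  shows "packed below_gt (S @ [[Suc i \<mapsto> s]])"
  using assms
proof (induction S)
  case Nil
  show ?case by (rule append_Nil[THEN ssubst], rule packed_ConsI) (auto simp: first_col_def)
next
  case (Cons c S)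
  let ?R = "row_word (c # S)" and ?R' = "row_word (c # S @ [[Suc i \<mapsto> s]])"
  have R': "?R' r = (if r = Suc i then ?R r @ [s] else ?R r)" for r
    by (auto split: option.split)
  have "packed below_gt (S @ [[Suc i \<mapsto> s]])"
    using Cons.prems packed_tl[OF Cons.prems(1)]
    by (intro Cons.IH) (auto simp: two_rowed_def split: option.splits)
  moreover have "c r = first_col below_gt ?R' r" for r
  proof -
    have "first_col below_gt ?R' r = first_col below_gt ?R r"
      using Cons.prems R' two_rowed_other[OF Cons.prems(2)]
      by (intro first_col_append_lower[of i ?R ?R' s]) auto
    then show ?thesis using packed_hd[OF Cons.prems(1)] by simp
  qed
  ultimately show ?case unfolding append_Cons by (rule packed_ConsI)
qed

text \<open>Row i+1 occupies exactly the columns before d, so its new last entry s lands in d, under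
  the cell of row i there.\<close>

lemma packed_insert_lower:
  assumes "packed below_gt (S1 @ d # S2)" "two_rowed i (S1 @ d # S2)"
    "\<forall>c\<in>set S1. c (Suc i) \<noteq> None" "\<forall>c\<in>set (d # S2). c (Suc i) = None"
    "\<forall>x\<in>set (row_word (S1 @ d # S2) i). x < s"
  shows "packed below_gt (S1 @ d(Suc i \<mapsto> s) # S2)"
  using assms
proof (induction S1)
  case Nil
  let ?R = "row_word (d # S2)" and ?R' = "row_word (d(Suc i \<mapsto> s) # S2)"
  have nil: "?R (Suc i) = []" using Nil.prems(4) unfolding row_word_eq_Nil .
  have R': "?R' r = (if r = Suc i then ?R r @ [s] else ?R r)" for r
    using nil by (auto split: option.splits)
  have other: "\<And>r. r \<noteq> i \<Longrightarrow> r \<noteq> Suc i \<Longrightarrow> ?R r = []"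
    using two_rowed_other[of i "d # S2"] Nil.prems(2) by simp
  have "(d(Suc i \<mapsto> s)) r = first_col below_gt ?R' r" for r
  proof (cases "r = Suc i")
    case True
    have "?R' (Suc i) = [s]" using R'[of "Suc i"] nil by (simp del: row_word_simps)
    moreover have "below_gt (Suc i) s r' y" if "y \<in> set (?R' r')" for r' y
      using other[of r'] R'[of r'] that by fastforce
    ultimately show ?thesis using True by (simp add: first_col_def del: row_word_simps)
  next
    case False
    have "first_col below_gt ?R' r = first_col below_gt ?R r"
      using Nil.prems R' other False
      by (intro first_col_append_lower[of i ?R ?R' s]) auto
    then show ?thesis using packed_hd[of below_gt d S2] Nil.prems(1) False by simp
  qed
  moreover have "packed below_gt S2" using packed_tl Nil.prems(1) by simp
  ultimately show ?case unfolding append_Nil by (intro packed_ConsI)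
next
  case (Cons c S)
  let ?R = "row_word (c # S @ d # S2)" and ?R' = "row_word (c # S @ d(Suc i \<mapsto> s) # S2)"
  have nil: "row_word S2 (Suc i) = []" "d (Suc i) = None" using Cons.prems(4) by (auto simp: row_word_eq_Nil)
  have R': "?R' r = (if r = Suc i then ?R r @ [s] else ?R r)" for r
    using nil by (auto split: option.split)
  have "packed below_gt (S @ d(Suc i \<mapsto> s) # S2)"
    using Cons.prems packed_tl[of below_gt c "S @ d # S2"]
    by (intro Cons.IH) (auto simp: two_rowed_def split: option.splits)
  moreover have "c r = first_col below_gt ?R' r" for r
  proof -
    have "first_col below_gt ?R' r = first_col below_gt ?R r"
      using Cons.prems R' two_rowed_other[OF Cons.prems(2)]
      by (intro first_col_append_lower[of i ?R ?R' s]) auto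
    then show ?thesis using packed_hd[of below_gt c "S @ d # S2"] Cons.prems(1) by simp
  qed
  ultimately show ?case unfolding append_Cons by (rule packed_ConsI)
qed

text \<open>The effect of \<open>e\<^sub>i\<close> on a left-justified array with the two rows \<open>i\<close> and \<open>i+1\<close>.\<close>

definition raises :: "nat \<Rightarrow> parray \<Rightarrow> parray \<Rightarrow> bool" where
  "raises i S S' \<longleftrightarrow> (\<exists>X d Y y. S = X @ d # Y \<and> d i = None \<and> d (Suc i) = Some y \<and>
     (\<forall>e\<in>set Y. e (Suc i) = None \<or> e i \<noteq> None) \<and> S' = X @ d(i := Some y, Suc i := None) # Y)"

lemma raises_move_up:
  assumes "raises i S S'"
  defines "C \<equiv> {c. (Suc i, c) \<in> cells S \<and> (i, c) \<notin> cells S}"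
  shows "C \<noteq> {}" "move_up i (Max C) S = S'"
proof -
  obtain X d Y y where S: "S = X @ d # Y" "d i = None" "d (Suc i) = Some y"
     "\<forall>e\<in>set Y. e (Suc i) = None \<or> e i \<noteq> None" "S' = X @ d(i := Some y, Suc i := None) # Y"
    using assms(1) unfolding raises_def by blast
  have len: "length X \<in> C" using S by (simp add: C_def cells_def)
  have "c \<le> length X" if "c \<in> C" for c
  proof (rule ccontr)
    assume "\<not> c \<le> length X"
    then obtain j where j: "c = Suc (length X + j)" using less_iff_Suc_add by (auto simp: not_le)
    have "j < length Y" "(Y ! j) (Suc i) \<noteq> None" "(Y ! j) i = None"
      using that j S(1) by (auto simp: C_def cells_def nth_append)
    moreover from this(1) have "Y ! j \<in> set Y" by simp
    ultimately show False using bspec[OF S(4), of "Y ! j"] by simp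
  qed
  moreover have "finite C" by (rule finite_subset[of _ "{..<length S}"]) (auto simp: C_def cells_def)
  ultimately have "Max C = length X" using len by (intro Max_eqI) auto
  then show "C \<noteq> {}" "move_up i (Max C) S = S'"
    using len S by (auto simp: move_up_def nth_append)
qed

lemma ex_raises:
  assumes "{c. (Suc i, c) \<in> cells S \<and> (i, c) \<notin> cells S} \<noteq> {}"
  shows "\<exists>S'. raises i S S'"
proof -
  have "\<exists>d\<in>set S. d (Suc i) \<noteq> None \<and> d i = None"
    using assms by (auto simp: cells_def intro: nth_mem)
  then obtain X d Y where S: "S = X @ d # Y" "d (Suc i) \<noteq> None" "d i = None"
     "\<forall>e\<in>set Y. \<not> (e (Suc i) \<noteq> None \<and> e i = None)"
    using split_list_last_prop[of S "\<lambda>d. d (Suc i) \<noteq> None \<and> d i = None"] by blast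
  then obtain y where "d (Suc i) = Some y" by blast
  then have "raises i S (X @ d(i := Some y, Suc i := None) # Y)"
    unfolding raises_def
    by (intro exI[of _ X] exI[of _ d] exI[of _ Y] exI[of _ y]) (use S in auto)
  then show ?thesis by blast
qed

text \<open>The raised y must not exceed the entries of row i to its right. The first of these, z,
  did not take the blank above y, so some w in row i+1, at y or later, satisfies w \<le> z. Row i+1
  is weakly increasing, hence y \<le> w \<le> z.\<close>

lemma raises_filling:
  assumes "raises i S S'" "filling S" "packed below_gt S" "two_rowed i S" "1 \<le> i"
  shows "filling S'"
proof -
  obtain X d Y y where S: "S = X @ d # Y" "d i = None" "d (Suc i) = Some y"
     "\<forall>e\<in>set Y. e (Suc i) = None \<or> e i \<noteq> None" "S' = X @ d(i := Some y, Suc i := None) # Y"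
    using assms(1) unfolding raises_def by blast
  have dom: "\<And>c r x. c \<in> set S \<Longrightarrow> c r = Some x \<Longrightarrow> r = i \<or> r = Suc i"
    using assms(4) by (auto simp: two_rowed_def dom_def subset_iff)
  let ?d = "d(i := Some y, Suc i := None)"
  have d': "?d = [i \<mapsto> y]"
    using dom[of d] S(1) by (fastforce simp: fun_eq_iff)
  have co: "\<And>e. e \<in> set X \<Longrightarrow> col_compat nw_order e d" "\<And>e. e \<in> set Y \<Longrightarrow> col_compat nw_order d e"
    "\<And>e. e \<in> set Y \<Longrightarrow> col_compat nw_order e e"
    using assms(2) unfolding S filling_iff spread_append spread_Cons by (auto simp: spread_def)
  have le: "y \<le> x" if e: "e \<in> set Y" and x: "e i = Some x" for e x
  proof -
    have "x \<in> set (row_word Y i)" using that in_row_word by blast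
    then obtain z zs where z: "row_word Y i = z # zs" by (cases "row_word Y i") auto
    have "sorted (row_word Y i)"
      using sorted_row_word[OF assms(2), of i] S(1,2) by (simp add: sorted_append)
    then have "z \<le> x" using \<open>x \<in> set (row_word Y i)\<close> z by auto
    have "packed below_gt (d # Y)" using assms(3) packed_appendD S(1) by blast
    then have "first_col below_gt (row_word (d # Y)) i = None"
      using packed_hd S(2) by metis
    then obtain r' w where w: "w \<in> set (row_word (d # Y) r')" "i < r'" "w \<le> z"
      using z S(2) by (auto simp: first_col_def split: if_splits)
    then obtain f where f: "f \<in> set (d # Y)" "f r' = Some w" unfolding in_row_word by blast
    then have "r' = Suc i" using dom[of f] S(1) w(2) by fastforce
    have "y \<le> w"
    proof (cases "f = d")
      case True then show ?thesis using f \<open>r' = Suc i\<close> S(3) by simp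
    next
      case False
      then have "f \<in> set Y" using f by simp
      from col_compatD[OF co(2)[OF this] S(3) f(2)] \<open>r' = Suc i\<close> show ?thesis by simp
    qed
    then show ?thesis using w(3) \<open>z \<le> x\<close> by simp
  qed
  have "col_compat nw_order e ?d" if "e \<in> set X" for e
    using col_compatD[OF co(1)[OF that] _ S(3)] unfolding d' by (fastforce simp: col_compat_def less_imp_le)
  moreover have "col_compat nw_order ?d e" if e: "e \<in> set Y" for e
    unfolding col_compat_def
  proof (intro allI impI)
    fix r x r' w assume h: "?d r = Some x" "e r' = Some w" "r \<le> r'"
    then have r: "r = i" "x = y" by (auto simp: d' split: if_splits)
    have "r' = i \<or> r' = Suc i" using dom[of e] h e S(1) by auto
    then show "x \<le> w \<and> (r < r' \<longrightarrow> x < w)"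
    proof
      assume "r' = i" then show ?thesis using le[OF e] h r by simp
    next
      assume r': "r' = Suc i"
      \<comment> \<open>The raised cell is the right-most uncovered one, so a later cell of row i+1
        has a cell above it: y \<le> z < w.\<close>
      then obtain z where z: "e i = Some z" using S(4) e h(2) r' by fastforce
      have "z < w" using col_compatD[OF co(3)[OF e] z h(2)] r' by simp
      then show ?thesis using le[OF e z] r by simp
    qed
  qed
  moreover have "col_compat nw_order ?d ?d" by (auto simp: d' col_compat_def split: if_splits)
  ultimately have "spread nw_order S'"
    using assms(2) unfolding S filling_iff spread_append spread_Cons by auto
  moreover have "\<forall>c\<in>set S'. \<forall>r x. c r = Some x \<longrightarrow> 1 \<le> r \<and> 1 \<le> x"
  proof -
    have *: "\<forall>c\<in>set S. \<forall>r x. c r = Some x \<longrightarrow> 1 \<le> r \<and> 1 \<le> x" using assms(2) filling_iff by blast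
    then have "1 \<le> y" using S(1,3) by auto
    with * show ?thesis using \<open>1 \<le> i\<close> unfolding S(1,5) d' by (auto split: if_splits)
  qed
  ultimately show ?thesis unfolding filling_iff by blast
qed

section \<open>Extensions and crystal operators\<close>

lemma filling_pos: "filling T \<Longrightarrow> x \<in> set (row_word T r) \<Longrightarrow> 1 \<le> r \<and> 1 \<le> x"
  unfolding filling_iff in_row_word by blast

lemma ptableau_filling: "ptableau n T \<Longrightarrow> filling T"
  by (simp add: ptableau_def)

lemma ptableau_row_Nil: "ptableau n T \<Longrightarrow> r \<notin> {1..n} \<Longrightarrow> row_word T r = []"
  unfolding ptableau_def row_word_eq_Nil by blast

lemma ptableau_finite: "ptableau n T \<Longrightarrow> finite {r. row_word T r \<noteq> []}"
  by (rule finite_subset[of _ "{1..n}"]) (use ptableau_row_Nil in blast)+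

text \<open>One cell per column, lower rows first. No cell then has a cell of a lower row to its
  right or in its column, so any sorted rows of positive entries are realised by a filling.\<close>

fun staircase :: "(nat \<Rightarrow> nat list) \<Rightarrow> nat \<Rightarrow> parray" where
  "staircase R 0 = []"
| "staircase R (Suc m) = map (\<lambda>x. [Suc m \<mapsto> x]) (R (Suc m)) @ staircase R m"

lemma row_word_single_row: "row_word (map (\<lambda>x. [k \<mapsto> x]) xs) r = (if r = k then xs else [])"
  by (induction xs) auto

lemma row_word_staircase: "row_word (staircase R m) r = (if 1 \<le> r \<and> r \<le> m then R r else [])"
  by (induction m) (auto simp: row_word_single_row le_Suc_eq)

lemma filling_staircase:
  assumes "\<And>r. sorted (R r)" "\<And>r x. x \<in> set (R r) \<Longrightarrow> 1 \<le> x"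
  shows "filling (staircase R m)"
proof -
  have "spread nw_order (staircase R m)"
  proof (induction m)
    case (Suc m)
    have "spread nw_order (map (\<lambda>x. [Suc m \<mapsto> x]) (R (Suc m)))"
      unfolding spread_def sorted_wrt_map
      using assms(1)[of "Suc m"] by (auto simp: col_compat_def elim!: sorted_wrt_mono_rel[rotated] split: if_splits)
    moreover have "col_compat nw_order [Suc m \<mapsto> x] d" if d: "d \<in> set (staircase R m)" for x d
      unfolding col_compat_def
    proof (intro allI impI)
      fix r z r' y assume h: "[Suc m \<mapsto> x] r = Some z" "d r' = Some y" "r \<le> r'"
      have "y \<in> set (row_word (staircase R m) r')" using d h in_row_word by blast
      then have "r' \<le> m" by (auto simp: row_word_staircase split: if_splits)
      with h show "z \<le> y \<and> (r < r' \<longrightarrow> z < y)" by (auto split: if_splits)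
    qed
    ultimately show ?case using Suc by (auto simp: spread_append)
  qed (simp add: spread_def)
  moreover have "1 \<le> r \<and> 1 \<le> x" if "c \<in> set (staircase R m)" "c r = Some x" for c r x
  proof -
    have "x \<in> set (row_word (staircase R m) r)" using that in_row_word by blast
    then show ?thesis using assms(2) by (auto simp: row_word_staircase split: if_splits)
  qed
  ultimately show ?thesis unfolding filling_iff by blast
qed

text \<open>Supplies the witness that the choice in \<open>crystal_e\<close> needs. If swaps on the
  justified staircase produced a blank column, deleting it would give a filling with the same rows
  and fewer columns, against minimality.\<close>

lemma ex_ptableau:
  assumes "\<And>r. sorted (R r)" "\<And>r x. x \<in> set (R r) \<Longrightarrow> 1 \<le> x" "\<And>r. r \<notin> {1..n} \<Longrightarrow> R r = []"
  shows "\<exists>T. ptableau n T \<and> (\<forall>r. row_word T r = R r)"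
proof -
  let ?Z = "staircase R n"
  have Z: "filling ?Z" using assms filling_staircase by blast
  have R: "row_word ?Z r = R r" for r using assms(3)[of r] by (auto simp: row_word_staircase)
  have fin: "finite {r. row_word ?Z r \<noteq> []}"
    by (rule finite_subset[of _ "{1..n}"]) (auto simp: row_word_staircase)
  let ?T = "left_justified ?Z"
  note T = left_justified_props[OF Z fin]
  have "dom c \<subseteq> {1..n}" if "c \<in> set ?T" for c
  proof
    fix r assume "r \<in> dom c"
    then obtain x where "c r = Some x" by blast
    then have "x \<in> set (row_word ?T r)" using that in_row_word by blast
    then show "r \<in> {1..n}" using T(2) assms(3)[of r] R by (cases "r \<in> {1..n}") auto
  qed
  moreover have "Map.empty \<notin> set S" if "same_ptableau ?T S" for S
  proof
    assume "Map.empty \<in> set S"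
    then have "length (drop_blank_columns S) < length S"
      unfolding drop_blank_columns_def by (intro length_filter_less) auto
    moreover have S: "filling S" "length S = length ?T" "row_word S = row_word ?T"
      using swaps_invariants that T(1) unfolding same_ptableau_def by blast+
    moreover have "length ?T \<le> length (drop_blank_columns S)"
      using S T(2) by (intro length_left_justified_le[OF Z fin] filling_drop_blank) auto
    ultimately show False by simp
  qed
  ultimately have "ptableau n ?T" using T(1) unfolding ptableau_def by blast
  then show ?thesis using T(2) R by metis
qed

section \<open>Biwords and extensions in terms of row words\<close>

lemma count_row_word: "card {c. c < length T \<and> (T ! c) w = Some t} = count_list (row_word T w) t"
proof -
  have "length (filter (\<lambda>c. c w = Some t) T) = count_list (row_word T w) t"
    by (induction T) (auto split: option.split)
  then show ?thesis by (simp add: length_filter_conv_card)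
qed

lemma ex_standard_form: "\<exists>bw. mset bw = mset ps \<and> standard_form bw"
proof -
  define n where "n = Max (insert 0 (snd ` set ps))"
  have n: "w \<le> n" if "(t, w) \<in> set ps" for t w
    unfolding n_def using that by (intro Max_ge) force+
  \<comment> \<open>The pair (t, n - w) read as a two-digit number in base n + 1. Since n bounds
    every w, the truncated subtraction loses nothing and reverses the order of w.\<close>
  define key where "key = (\<lambda>(t, w). t * Suc n + (n - w) :: nat)"
  let ?bw = "sort_key key ps"
  have "sorted_wrt (\<lambda>p q. key p \<le> key q) ?bw"
    using sorted_sort_key[of key ps] by (simp add: sorted_wrt_map)
  then have "standard_form ?bw"
    unfolding standard_form_def
  proof (rule sorted_wrt_mono_rel[rotated])
    fix p q assume pq: "p \<in> set ?bw" "q \<in> set ?bw" "key p \<le> key q"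
    obtain t w t' w' where p: "p = (t, w)" "q = (t', w')" by (cases p, cases q)
    have w: "w \<le> n" "w' \<le> n" using n pq p by auto
    have "t \<le> t'"
    proof (rule ccontr)
      assume "\<not> t \<le> t'"
      then have "Suc t' * Suc n \<le> t * Suc n" by (intro mult_le_mono1) simp
      then show False using pq(3) w by (simp add: key_def p)
    qed
    then show "(case p of (t, w) \<Rightarrow> \<lambda>(t', w'). t < t' \<or> t = t' \<and> w' \<le> w) q"
      using pq(3) w by (auto simp: key_def p)
  qed
  then show ?thesis by (intro exI[of _ ?bw]) simp
qed

lemma ex_biword:
  assumes "finite {r. row_word T r \<noteq> []}"
  shows "\<exists>bw. biword_of T bw"
proof -
  obtain ws where ws: "set ws = {r. row_word T r \<noteq> []}" "distinct ws"
    using finite_distinct_list[OF assms] by blast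
  have single: "count_list (map (\<lambda>t. (t, v)) xs) (t, w) = (if v = w then count_list xs t else 0)"
    for v w t :: nat and xs
    by (induction xs) auto
  let ?ps = "\<lambda>ws. concat (map (\<lambda>w. map (\<lambda>t. (t, w)) (row_word T w)) ws)"
  have "distinct vs \<Longrightarrow> count_list (?ps vs) (t, w) = (if w \<in> set vs then count_list (row_word T w) t else 0)" for vs t w
    by (induction vs) (auto simp: single)
  with ws have "count_list (?ps ws) (t, w) = count_list (row_word T w) t" for t w
    by auto
  moreover obtain bw where "mset bw = mset (?ps ws)" "standard_form bw" using ex_standard_form by blast
  moreover from this(1) have "count_list bw p = count_list (?ps ws) p" for p
    by (metis count_mset)
  ultimately show ?thesis unfolding biword_of_def count_row_word by auto
qed

text \<open>A biword records only multiplicities, but the rows of a filling are sorted, so these fix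
  the row words. Standard form of the longer biword amounts to the condition on s and a.\<close>

lemma extension_iff:
  "extension n T s a T' \<longleftrightarrow> ptableau n T \<and> ptableau n T' \<and>
     (\<forall>r. row_word T' r = (if r = a then row_word T r @ [s] else row_word T r)) \<and>
     (\<forall>r. \<forall>t\<in>set (row_word T r). t < s \<or> t = s \<and> a \<le> r)" (is "_ \<longleftrightarrow> ?R")
proof
  assume "extension n T s a T'"
  then obtain bw where T: "ptableau n T" "ptableau n T'" and bw: "biword_of T bw" "biword_of T' (bw @ [(s, a)])"
    unfolding extension_def by blast
  have c: "count_list bw (t, w) = count_list (row_word T w) t" for t w
    using bw(1) unfolding biword_of_def count_row_word by blast
  have c': "count_list (row_word T' w) t = count_list (row_word T w) t + (if (t, w) = (s, a) then 1 else 0)" for t w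
  proof -
    have "count_list (bw @ [(s, a)]) (t, w) = count_list (row_word T' w) t"
      using bw(2) unfolding biword_of_def count_row_word by blast
    then show ?thesis using c[of t w] by auto
  qed
  have std: "t < s \<or> t = s \<and> a \<le> r" if "t \<in> set (row_word T r)" for t r
  proof -
    have "count_list bw (t, r) \<noteq> 0" using that c by (simp add: count_list_0_iff)
    then have "(t, r) \<in> set bw" by (metis count_list_0_iff)
    then show ?thesis
      using bw(2) unfolding biword_of_def standard_form_def sorted_wrt_append by auto
  qed
  have "row_word T' r = (if r = a then row_word T r @ [s] else row_word T r)" for r
  proof -
    let ?w = "if r = a then row_word T r @ [s] else row_word T r"
    have m: "mset (row_word T' r) = mset ?w"
      by (rule multiset_eqI) (auto simp: c' count_mset)
    \<comment> \<open>s is at least every entry of row a, so appending it keeps the row sorted;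
      equal multisets then force equal words.\<close>
    have w: "sorted ?w"
      using sorted_row_word[OF ptableau_filling[OF T(1)]] std by (fastforce simp: sorted_append)
    have "sort ?w = row_word T' r"
      using m sorted_row_word[OF ptableau_filling[OF T(2)]] by (rule properties_for_sort)
    then show ?thesis unfolding sorted_sort_id[OF w] by (rule sym)
  qed
  then show ?R using T std by blast
next
  assume R: ?R
  then obtain bw where bw: "biword_of T bw" using ex_biword ptableau_finite by blast
  have c: "count_list bw (t, w) = count_list (row_word T w) t" for t w
    using bw(1) unfolding biword_of_def count_row_word by blast
  have "standard_form (bw @ [(s, a)])"
    unfolding standard_form_def sorted_wrt_append
  proof (intro conjI ballI)
    show "sorted_wrt (\<lambda>(t, w) (t', w'). t < t' \<or> t = t' \<and> w' \<le> w) bw"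
      using bw unfolding biword_of_def standard_form_def by blast
    fix p q assume "p \<in> set bw" "q \<in> set [(s, a)]"
    moreover obtain t w where p: "p = (t, w)" by (cases p)
    ultimately have "t \<in> set (row_word T w)" using c[of t w] by (metis count_list_0_iff)
    then show "(case p of (t, w) \<Rightarrow> \<lambda>(t', w'). t < t' \<or> t = t' \<and> w' \<le> w) q"
      using R p \<open>q \<in> set [(s, a)]\<close> by auto
  qed simp
  moreover have "count_list (bw @ [(s, a)]) (t, w) = count_list (row_word T' w) t" for t w
    using R by (simp add: c)
  ultimately have "biword_of T' (bw @ [(s, a)])" unfolding biword_of_def count_row_word by blast
  then show "extension n T s a T'" using R bw unfolding extension_def by blast
qed

lemma extension_row: "extension n T s a T' \<Longrightarrow> a \<in> {1..n}"
  unfolding extension_iff using ptableau_row_Nil[of n T' a] by (cases "a \<in> {1..n}") auto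

text \<open>By \<open>raises_filling\<close> the two new rows are sorted, and sorted rows of
  positive entries can always be combined into a ptableau, so the choice in \<open>crystal_e\<close>
  has a witness.\<close>

lemma crystal_e_raises:
  assumes T: "ptableau n T" and i: "i \<in> {1..<n}" and S: "raises i (left_rows i T) S"
  shows "\<exists>U. crystal_e n i T = Some U \<and> ptableau n U \<and>
    (\<forall>r. row_word U r = (if r \<in> {i, Suc i} then row_word S r else row_word T r))"
proof -
  let ?R = "\<lambda>r. if r \<in> {i, Suc i} then row_word S r else row_word T r"
  note f = ptableau_filling[OF T]
  have fS: "filling S"
    using raises_filling[OF S] left_rows_props[OF f] two_rowed_left_rows[OF f] i by simp
  have "\<exists>U. ptableau n U \<and> (\<forall>r. row_word U r = ?R r)"
    using i filling_pos[OF fS] filling_pos[OF f] sorted_row_word[OF fS] sorted_row_word[OF f]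
    by (intro ex_ptableau) (auto intro: ptableau_row_Nil[OF T] split: if_splits)
  from someI_ex[OF this] show ?thesis
    unfolding crystal_e_def Let_def raises_move_up(2)[OF S] if_not_P[OF raises_move_up(1)[OF S]]
    by blast
qed

lemma crystal_e_SomeD:
  assumes T: "ptableau n T" and i: "i \<in> {1..<n}" and U: "crystal_e n i T = Some U"
  obtains S where "raises i (left_rows i T) S" "ptableau n U"
    "\<And>r. row_word U r = (if r \<in> {i, Suc i} then row_word S r else row_word T r)"
proof -
  have "{c. (Suc i, c) \<in> cells (left_rows i T) \<and> (i, c) \<notin> cells (left_rows i T)} \<noteq> {}"
    using U unfolding crystal_e_def Let_def by (auto split: if_splits)
  then obtain S where "raises i (left_rows i T) S" using ex_raises by blast
  with crystal_e_raises[OF T i this] U that show ?thesis by auto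
qed

section \<open>The tensor product rule\<close>

lemma raises_row_sets:
  assumes "raises i S S'"
  shows "set (row_word S' (Suc i)) \<subseteq> set (row_word S (Suc i))"
    "set (row_word S' i) \<subseteq> set (row_word S i) \<union> set (row_word S (Suc i))"
  using assms unfolding raises_def by (auto split: option.splits)

text \<open>\<open>S1\<close> holds all of row i+1, one cell per column, so \<open>phi_eq\<close>
  makes \<phi>_i(T) the length of \<open>S2\<close>, the number of columns with room in row
  i+1.\<close>

lemma phi_zero_split:
  assumes f: "filling T"
  obtains S1 S2 where "left_rows i T = S1 @ S2" "\<forall>c\<in>set S1. c (Suc i) \<noteq> None"
    "\<forall>c\<in>set S2. c (Suc i) = None" "phi i T = 0 \<longleftrightarrow> S2 = []"
proof -
  obtain S1 S2 where S: "left_rows i T = S1 @ S2" "\<forall>c\<in>set S1. c (Suc i) \<noteq> None"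
    "\<forall>c\<in>set S2. c (Suc i) = None"
    using two_rowed_split[OF left_rows_props(4)[OF f] two_rowed_left_rows[OF f]] by blast
  have "row_word T (Suc i) = row_word (S1 @ S2) (Suc i)"
    using left_rows_props(2)[OF f, of i] S(1) by (simp add: row_word_two_rows)
  also have "length \<dots> = length S1"
    using S(2,3) unfolding length_row_word by (simp add: filter_True filter_False)
  finally have "phi i T = length S2" using phi_eq[OF f, of i] S(1) by simp
  then show ?thesis using that S by simp
qed

text \<open>The new cell neither moves the others nor changes the right-most uncovered cell: in row
  i it takes a last column of its own, and in row i+1 with \<phi>_i(T) \<noteq> 0 it settles under a
  cell of row i.\<close>

lemma crystal_e_extension_left:
  assumes ext: "extension n T s a T'" and i: "i \<in> {1..<n}" and U: "crystal_e n i T = Some U"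
    and a: "a = Suc i \<Longrightarrow> phi i T \<noteq> 0"
  shows "\<exists>U'. crystal_e n i T' = Some U' \<and> extension n U s a U'"
proof -
  have T: "ptableau n T" and T': "ptableau n T'"
    and R: "\<And>r. row_word T' r = (if r = a then row_word T r @ [s] else row_word T r)"
    and std: "\<And>r t. t \<in> set (row_word T r) \<Longrightarrow> t < s \<or> t = s \<and> a \<le> r"
    using ext unfolding extension_iff by blast+
  note f = ptableau_filling[OF T] and f' = ptableau_filling[OF T']
  let ?L = "left_rows i T" and ?L' = "left_rows i T'"
  have Li: "row_word ?L r = (if r \<in> {i, Suc i} then row_word T r else [])" for r
    using left_rows_props(2)[OF f] by (simp add: row_word_two_rows)
  obtain S where S: "raises i ?L S" "ptableau n U"
    "\<And>r. row_word U r = (if r \<in> {i, Suc i} then row_word S r else row_word T r)"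
    using crystal_e_SomeD[OF T i U] by blast
  obtain X d Y y where S_def: "?L = X @ d # Y" "d i = None" "d (Suc i) = Some y"
     "\<forall>e\<in>set Y. e (Suc i) = None \<or> e i \<noteq> None" "S = X @ d(i := Some y, Suc i := None) # Y"
    using S(1) unfolding raises_def by blast
  let ?d = "d(i := Some y, Suc i := None)"
  \<comment> \<open>The last conjunct serves standard form: for a = i+1 the raised cell enters row
    i, where an entry equal to s, harmless in row i+1, is forbidden.\<close>
  have "\<exists>S'. raises i ?L' S' \<and>
     (\<forall>r\<in>{i, Suc i}. row_word S' r = (if r = a then row_word S r @ [s] else row_word S r)) \<and>
     (a = Suc i \<longrightarrow> (\<forall>t\<in>set (row_word S i). t < s))"
  proof -
    consider "a \<noteq> i" "a \<noteq> Suc i" | "a = i" | "a = Suc i" by blast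
    then show ?thesis
    proof cases
      case 1
      then have "?L' = ?L" using R by (intro left_rows_cong[OF f' f]) auto
      then show ?thesis using S(1) 1 by auto
    next
      case 2
      have "?L' = ?L @ [[i \<mapsto> s]]"
      proof (rule left_rows_eqI[OF f'])
        show "packed below_gt (?L @ [[i \<mapsto> s]])"
          using std Li[of "Suc i"]
          by (intro packed_append_upper left_rows_props(4) two_rowed_left_rows f) fastforce
      qed (use left_rows_props(3)[OF f] Li R 2 in \<open>auto simp: fun_eq_iff\<close>)
      then have "raises i ?L' (S @ [[i \<mapsto> s]])"
        unfolding raises_def using S_def
        by (intro exI[of _ X] exI[of _ d] exI[of _ "Y @ [[i \<mapsto> s]]"] exI[of _ y]) auto
      then show ?thesis using 2 by (intro exI[of _ "S @ [[i \<mapsto> s]]"]) auto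
    next
      case 3
      obtain S1 S2 where S12: "?L = S1 @ S2" "\<forall>c\<in>set S1. c (Suc i) \<noteq> None"
        "\<forall>c\<in>set S2. c (Suc i) = None" "phi i T = 0 \<longleftrightarrow> S2 = []"
        using phi_zero_split[OF f] by blast
      then obtain g G where G: "S2 = g # G" using a[OF 3] by (cases S2) auto
      have less: "\<forall>t\<in>set (row_word T i). t < s" using std[of _ i] 3 by fastforce
      have nil: "row_word G (Suc i) = []" "g (Suc i) = None"
        using S12(3) G by (auto simp: row_word_eq_Nil)
      have L': "?L' = S1 @ g(Suc i \<mapsto> s) # G"
      proof (rule left_rows_eqI[OF f'])
        show "packed below_gt (S1 @ g(Suc i \<mapsto> s) # G)"
        proof (rule packed_insert_lower)
          show "packed below_gt (S1 @ g # G)" "two_rowed i (S1 @ g # G)"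
            using left_rows_props(4)[OF f, of i] two_rowed_left_rows[OF f, of i] S12(1) G by simp_all
          show "\<forall>x\<in>set (row_word (S1 @ g # G) i). x < s"
            using Li[of i] less S12(1) G by simp
        qed (use S12 G in auto)
        show "Map.empty \<notin> set (S1 @ g(Suc i \<mapsto> s) # G)"
        proof -
          have "Map.empty \<noteq> g(Suc i \<mapsto> s)" by (metis fun_upd_same option.distinct(1))
          then show ?thesis using left_rows_props(3)[OF f, of i] S12(1) G by auto
        qed
        show "row_word (S1 @ g(Suc i \<mapsto> s) # G) r = (if r \<in> {i, Suc i} then row_word T' r else [])" for r
        proof -
          have "row_word (S1 @ g(Suc i \<mapsto> s) # G) r
            = (if r = Suc i then row_word (S1 @ g # G) r @ [s] else row_word (S1 @ g # G) r)"
            using nil by (auto split: option.split)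
          then show ?thesis using Li[of r] R[of r] 3 S12(1) G by (auto simp del: row_word_simps)
        qed
      qed
      have "d \<in> set S1"
      proof -
        have "d \<in> set (S1 @ S2)" using S_def(1) S12(1) by (metis in_set_conv_decomp)
        then show ?thesis using S12(3) S_def(3) by auto
      qed
      \<comment> \<open>d has a cell in row i+1 and so lies in \<open>S1\<close>; the new cell
        settles further right, in g.\<close>
      obtain Y1 where Y1: "S1 = X @ d # Y1" "Y = Y1 @ g # G"
      proof -
        have "X @ d # Y = S1 @ S2" using S_def(1) S12(1) by simp
        then obtain us where "X = S1 @ us \<and> us @ d # Y = S2 \<or> X @ us = S1 \<and> d # Y = us @ S2"
          unfolding append_eq_append_conv2 by blast
        then show ?thesis
        proof
          assume "X = S1 @ us \<and> us @ d # Y = S2"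
          then have "d \<in> set S2" by auto
          then show ?thesis using S12(3) S_def(3) by auto
        next
          assume *: "X @ us = S1 \<and> d # Y = us @ S2"
          show ?thesis
          proof (cases us)
            case Nil
            then have "d \<in> set S2" using * by (metis append_Nil list.set_intros(1))
            then show ?thesis using S12(3) S_def(3) by auto
          next
            case (Cons u us')
            then show ?thesis using that[of us'] * G by auto
          qed
        qed
      qed
      let ?S' = "X @ ?d # Y1 @ g(Suc i \<mapsto> s) # G"
      have "g i \<noteq> None"
        using two_rowed_column[OF two_rowed_left_rows[OF f, of i], of g] nil S12(1) G by auto
      have S': "raises i ?L' ?S'"
        unfolding raises_def L'
        by (intro exI[of _ X] exI[of _ d] exI[of _ "Y1 @ g(Suc i \<mapsto> s) # G"] exI[of _ y])
          (use S_def Y1 \<open>g i \<noteq> None\<close> in auto)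
      \<comment> \<open>Strictness comes from the order itself: in the filling obtained by raising,
        the entries of row i before g, the raised one included, lie above and to the left of s,
        hence are smaller.\<close>
      have "filling ?S'"
        using raises_filling[OF S'] left_rows_props[OF f'] two_rowed_left_rows[OF f'] i by simp
      then have co: "\<And>e. e \<in> set (X @ ?d # Y1) \<Longrightarrow> col_compat nw_order e (g(Suc i \<mapsto> s))"
        unfolding filling_iff spread_append spread_Cons by auto
      have "t < s" if t: "t \<in> set (row_word S i)" for t
      proof -
        obtain e where e: "e \<in> set S" "e i = Some t" using t in_row_word by blast
        then have "e \<in> set (X @ ?d # Y1) \<or> e \<in> set ?L"
          unfolding S_def(5) S_def(1) Y1(2) by auto
        then show ?thesis
        proof
          assume "e \<in> set (X @ ?d # Y1)"
          from col_compatD[OF co[OF this] e(2), of "Suc i" s] show ?thesis by simp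
        next
          assume "e \<in> set ?L"
          then have "t \<in> set (row_word ?L i)" using e in_row_word by blast
          then show ?thesis using less Li[of i] by simp
        qed
      qed
      moreover have "row_word ?S' r = (if r = a then row_word S r @ [s] else row_word S r)" for r
        using nil 3 unfolding S_def(5) Y1(2) by (auto split: option.split)
      ultimately show ?thesis using S' by blast
    qed
  qed
  then obtain S' where S': "raises i ?L' S'"
     "\<And>r. r \<in> {i, Suc i} \<Longrightarrow> row_word S' r = (if r = a then row_word S r @ [s] else row_word S r)"
     "a = Suc i \<Longrightarrow> \<forall>t\<in>set (row_word S i). t < s" by blast
  obtain U' where U': "crystal_e n i T' = Some U'" "ptableau n U'"
    "\<And>r. row_word U' r = (if r \<in> {i, Suc i} then row_word S' r else row_word T' r)"
    using crystal_e_raises[OF T' i S'(1)] by blast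
  have "t < s \<or> t = s \<and> a \<le> r" if t: "t \<in> set (row_word U r)" for t r
  proof -
    consider "r \<notin> {i, Suc i}" | "r = Suc i" | "r = i" by blast
    then show ?thesis
    proof cases
      case 1
      then show ?thesis using S(3)[of r] t std by simp
    next
      case 2
      then have "t \<in> set (row_word T (Suc i))"
        using S(3)[of r] t raises_row_sets(1)[OF S(1)] Li[of "Suc i"] by auto
      then show ?thesis using std 2 by simp
    next
      case 3
      then have tS: "t \<in> set (row_word S i)" using S(3)[of r] t by simp
      then have "t \<in> set (row_word T i) \<or> t \<in> set (row_word T (Suc i))"
        using raises_row_sets(2)[OF S(1)] Li[of i] Li[of "Suc i"] by auto
      then show ?thesis using std[of t i] std[of t "Suc i"] S'(3) tS 3 by (cases "a = Suc i") auto
    qed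
  qed
  moreover have "row_word U' r = (if r = a then row_word U r @ [s] else row_word U r)" for r
    using U'(3)[of r] S'(2)[of r] S(3)[of r] R[of r] by auto
  ultimately have "extension n U s a U'" unfolding extension_iff using S(2) U'(2) by blast
  then show ?thesis using U'(1) by blast
qed

text \<open>Every column has a cell in row i+1, so s opens a last column, uncovered and right-most,
  and is the cell that e_i raises. Passing from row i+1 to row i only relaxes what standard form
  asks of s.\<close>

lemma crystal_e_extension_right:
  assumes ext: "extension n T s (Suc i) T'" and i: "i \<in> {1..<n}" and phi: "phi i T = 0"
  shows "\<exists>U'. crystal_e n i T' = Some U' \<and> extension n T s i U'"
proof -
  have T: "ptableau n T" and T': "ptableau n T'"
    and R: "\<And>r. row_word T' r = (if r = Suc i then row_word T r @ [s] else row_word T r)"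
    and std: "\<And>r t. t \<in> set (row_word T r) \<Longrightarrow> t < s \<or> t = s \<and> Suc i \<le> r"
    using ext unfolding extension_iff by blast+
  note f = ptableau_filling[OF T] and f' = ptableau_filling[OF T']
  let ?L = "left_rows i T" and ?L' = "left_rows i T'"
  have Li: "row_word ?L r = (if r \<in> {i, Suc i} then row_word T r else [])" for r
    using left_rows_props(2)[OF f] by (simp add: row_word_two_rows)
  have "\<forall>c\<in>set ?L. c (Suc i) \<noteq> None"
    using phi_zero_split[OF f, of i] phi by (metis append_Nil2)
  have "?L' = ?L @ [[Suc i \<mapsto> s]]"
  proof (rule left_rows_eqI[OF f'])
    show "packed below_gt (?L @ [[Suc i \<mapsto> s]])"
    proof (rule packed_append_lower)
      show "\<forall>x\<in>set (row_word ?L i). x < s" using Li[of i] std[of _ i] by fastforce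
    qed (fact left_rows_props(4)[OF f] two_rowed_left_rows[OF f] \<open>\<forall>c\<in>set ?L. c (Suc i) \<noteq> None\<close>)+
  qed (use left_rows_props(3)[OF f] Li R in \<open>auto simp: fun_eq_iff\<close>)
  then have "raises i ?L' (?L @ [[i \<mapsto> s]])"
    unfolding raises_def
    by (intro exI[of _ ?L] exI[of _ "[Suc i \<mapsto> s]"] exI[of _ "[]"] exI[of _ s]) (auto simp: fun_eq_iff)
  then obtain U' where U': "crystal_e n i T' = Some U'" "ptableau n U'"
    "\<And>r. row_word U' r = (if r \<in> {i, Suc i} then row_word (?L @ [[i \<mapsto> s]]) r else row_word T' r)"
    using crystal_e_raises[OF T' i] by blast
  moreover have "row_word U' r = (if r = i then row_word T r @ [s] else row_word T r)" for r
    using U'(3)[of r] Li[of r] R[of r] by auto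
  moreover have "t < s \<or> t = s \<and> i \<le> r" if "t \<in> set (row_word T r)" for t r
    using std[OF that] by auto
  ultimately have "extension n T s i U'" unfolding extension_iff using T by blast
  then show ?thesis using U'(1) by blast
qed

section \<open>Highest weight extensions\<close>

lemma partition_shaped_iff:
  assumes "filling S"
  shows "partition_shaped S \<longleftrightarrow>
    (\<forall>c\<in>set S. \<forall>r q. c r \<noteq> None \<longrightarrow> 1 \<le> q \<longrightarrow> q \<le> r \<longrightarrow> c q \<noteq> None) \<and>
    sorted_wrt (\<lambda>c d. \<forall>r. d r \<noteq> None \<longrightarrow> c r \<noteq> None) S" (is "_ \<longleftrightarrow> ?C \<and> ?S")
proof -
  have pos: "1 \<le> r" if "(r, k) \<in> cells S" for r k
    using that assms unfolding filling_iff cells_def by force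
  show ?thesis
  proof
    assume p: "partition_shaped S"
    then have p: "(q, j) \<in> cells S" if "(r, k) \<in> cells S" "1 \<le> q" "q \<le> r" "j \<le> k" for q j r k
      using that unfolding partition_shaped_def by blast
    have ?C
    proof (intro ballI allI impI)
      fix c r q assume h: "c \<in> set S" "c r \<noteq> None" "1 \<le> q" "q \<le> r"
      then obtain k where k: "k < length S" "S ! k = c" by (metis in_set_conv_nth)
      with h p[of r k q k] show "c q \<noteq> None" by (simp add: cells_def)
    qed
    moreover have ?S
      unfolding sorted_wrt_iff_nth_less
    proof (intro allI impI)
      fix j k r assume h: "j < k" "k < length S" "(S ! k) r \<noteq> None"
      then have "(r, k) \<in> cells S" by (simp add: cells_def)
      from p[OF this pos[OF this], of j] h show "(S ! j) r \<noteq> None" by (simp add: cells_def)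
    qed
    ultimately show "?C \<and> ?S" ..
  next
    assume CS: "?C \<and> ?S"
    have "(q, j) \<in> cells S" if h: "(r, k) \<in> cells S" "1 \<le> q" "q \<le> r" "j \<le> k" for q j r k
    proof -
      have k: "k < length S" "(S ! k) r \<noteq> None" using h(1) by (simp_all add: cells_def)
      then have "(S ! k) q \<noteq> None" using CS h nth_mem[of k S] by metis
      moreover have "(S ! k) q \<noteq> None \<longrightarrow> (S ! j) q \<noteq> None"
      proof (cases "j = k")
        case False
        then show ?thesis
          using sorted_wrt_nth_less[OF conjunct2[OF CS], of j k] h(4) k(1) by simp
      qed simp
      ultimately show ?thesis using h(4) k(1) by (simp add: cells_def)
    qed
    then show "partition_shaped S" unfolding partition_shaped_def using pos by blast
  qed
qed

text \<open>The order conditions on rows and columns are instances of \<open>nw_order\<close>, so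
  only the shape matters.\<close>

lemma semistandard_iff:
  assumes "filling S"
  shows "semistandard S \<longleftrightarrow> partition_shaped S"
proof -
  have s: "sorted_wrt (col_compat nw_order) S" "\<And>c. c \<in> set S \<Longrightarrow> col_compat nw_order c c"
    using assms unfolding filling_iff spread_def by blast+
  have "the ((S ! k) r) \<le> the ((S ! Suc k) r)" if "(r, k) \<in> cells S" "(r, Suc k) \<in> cells S" for r k
  proof -
    have "col_compat nw_order (S ! k) (S ! Suc k)"
      using s(1) that unfolding sorted_wrt_iff_nth_less cells_def by simp
    from col_compatD[OF this, of r _ r] that show ?thesis by (auto simp: cells_def)
  qed
  moreover have "the ((S ! k) r) < the ((S ! k) (Suc r))" if "(r, k) \<in> cells S" "(Suc r, k) \<in> cells S" for r k
  proof -
    have "col_compat nw_order (S ! k) (S ! k)"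
      using s(2)[of "S ! k"] that unfolding cells_def by simp
    from col_compatD[OF this, of r _ "Suc r"] that show ?thesis by (auto simp: cells_def)
  qed
  ultimately show ?thesis unfolding semistandard_def by blast
qed

text \<open>No cell of a partition shape has a blank to its left, so tightness is vacuous.\<close>

lemma partition_shaped_packed:
  assumes "filling S" "partition_shaped S" shows "packed below_gt S"
proof (rule tight_packed)
  have "sorted_wrt (\<lambda>c d. \<forall>r. d r \<noteq> None \<longrightarrow> c r \<noteq> None) S"
    using assms partition_shaped_iff by blast
  then have "successively (\<lambda>c d. \<forall>r. d r \<noteq> None \<longrightarrow> c r \<noteq> None) S"
    by (rule successively_if_sorted_wrt)
  then show "successively (tight below_gt) S"
    by (rule successively_mono) (auto simp: tight_def)
qed (use assms filling_spread_left in auto)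

text \<open>\<open>S1\<close> alone arranges rows j and j+1 in as many columns as row j+1 has cells.
  The left-justified form has no more columns, which by \<open>phi_eq\<close> leaves \<phi>_j(U) =
  0.\<close>

lemma phi_zero_of_full_columns:
  assumes f: "filling U" and S: "filling (S1 @ S2)" "row_word (S1 @ S2) = row_word U"
    and "\<forall>c\<in>set S1. c (Suc j) \<noteq> None" "\<forall>c\<in>set S2. c (Suc j) = None" "\<forall>c\<in>set S2. c j = None"
  shows "phi j U = 0"
proof -
  have f1: "filling S1" using S(1) unfolding filling_iff spread_append by (simp add: ball_Un)
  have nil: "row_word S2 j = []" "row_word S2 (Suc j) = []" using assms by (auto simp: row_word_eq_Nil)
  then have U: "row_word U j = row_word S1 j" "row_word U (Suc j) = row_word S1 (Suc j)"
    by (simp_all flip: S(2))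
  have "length (left_rows j U) \<le> length (two_rows j S1)"
    using U by (intro length_left_justified_le filling_two_rows finite_two_rows f f1)
      (auto simp: fun_eq_iff row_word_two_rows)
  also have "\<dots> \<le> length S1" by (simp add: two_rows_def drop_blank_columns_def length_filter_le[THEN order_trans])
  also have "\<dots> = length (row_word U (Suc j))"
    using assms(4) unfolding U length_row_word by (simp add: filter_True)
  finally show ?thesis using phi_eq[OF f, of j] by simp
qed

text \<open>The box at the end of row b is an addable corner of the shape of \<open>U\<close> when b
  = 1 or row b-1 is longer than row b; \<phi>_(b-1)(U) \<noteq> 0 guarantees the latter.\<close>

lemma highest_weight_extension:
  assumes hw: "highest_weight U" and ext: "extension n U s b U'"
    and phi: "\<And>j. b = Suc j \<Longrightarrow> j \<noteq> 0 \<Longrightarrow> phi j U \<noteq> 0"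
  shows "highest_weight U' \<and> partition_shaped (left_justified U')"
proof -
  have U: "ptableau n U" and U': "ptableau n U'"
    and R: "\<And>r. row_word U' r = (if r = b then row_word U r @ [s] else row_word U r)"
    and std: "\<And>r t. t \<in> set (row_word U r) \<Longrightarrow> t < s \<or> t = s \<and> b \<le> r"
    using ext unfolding extension_iff by blast+
  note f = ptableau_filling[OF U] and f' = ptableau_filling[OF U']
  have b: "1 \<le> b" using extension_row[OF ext] by simp
  have s: "1 \<le> s" using filling_pos[OF f', of s b] R[of b] by simp
  let ?S = "left_justified U"
  note S = left_justified_props[OF f ptableau_finite[OF U]]
  have "partition_shaped ?S" using hw semistandard_iff[OF S(1)] by (simp add: highest_weight_def)
  then have col: "\<And>c r q. c \<in> set ?S \<Longrightarrow> c r \<noteq> None \<Longrightarrow> 1 \<le> q \<Longrightarrow> q \<le> r \<Longrightarrow> c q \<noteq> None"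
    and row: "sorted_wrt (\<lambda>c d. \<forall>r. d r \<noteq> None \<longrightarrow> c r \<noteq> None) ?S"
    unfolding partition_shaped_iff[OF S(1)] by blast+
  define S1 where "S1 = takeWhile (\<lambda>c. c b \<noteq> None) ?S"
  define S2 where "S2 = dropWhile (\<lambda>c. c b \<noteq> None) ?S"
  have S12: "?S = S1 @ S2" by (simp add: S1_def S2_def)
  have S1: "\<forall>c\<in>set S1. c b \<noteq> None" unfolding S1_def by (metis set_takeWhileD)
  have S2_None: "c r = None" if "S2 = d # D" "d r = None" "c \<in> set S2" for d D c r
  proof (cases "c = d")
    case False
    then have "\<forall>r. c r \<noteq> None \<longrightarrow> d r \<noteq> None"
      using row that unfolding S12 sorted_wrt_append by simp
    then show ?thesis using that(2) by blast
  qed (use that in simp)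
  have S2: "\<forall>c\<in>set S2. c b = None"
  proof (cases S2)
    case (Cons d D)
    then have "d b = None" unfolding S2_def by (metis (mono_tags) dropWhile_eq_Cons_conv)
    then show ?thesis using S2_None[OF Cons] by blast
  qed simp
  have below: "\<exists>c\<in>set S2. c j \<noteq> None" if "b = Suc j" "j \<noteq> 0" for j
  proof (rule ccontr)
    assume "\<not> (\<exists>c\<in>set S2. c j \<noteq> None)"
    then have "\<forall>c\<in>set S2. c j = None" by blast
    then have "phi j U = 0"
      using phi_zero_of_full_columns[OF f, of S1 S2 j] S(1,2) S12 S1 S2 \<open>b = Suc j\<close> by simp
    then show False using phi that by blast
  qed
  \<comment> \<open>d is the column that receives s, the first with a blank in row b. If there is
    none, then b = 1 and s opens a new column, for which a blank one is appended.\<close>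
  obtain d D where dD: "S1 @ d # D = ?S \<or> S1 @ d # D = ?S @ [Map.empty]"
    "\<forall>c\<in>set (d # D). c b = None" "\<forall>q. 1 \<le> q \<longrightarrow> q < b \<longrightarrow> d q \<noteq> None"
    "\<forall>c\<in>set D. c \<noteq> Map.empty"
  proof (cases S2)
    case Nil
    then have "b = 1" using below[of "b - 1"] b by fastforce
    then show thesis using that[of Map.empty "[]"] S12 Nil by simp
  next
    case (Cons d D)
    have "d q \<noteq> None" if q: "1 \<le> q" "q < b" for q
    proof -
      have "b = Suc (b - 1)" "b - 1 \<noteq> 0" using q by auto
      from below[OF this] have "d (b - 1) \<noteq> None" using S2_None[OF Cons] by metis
      then show ?thesis using col[of d "b - 1" q] S12 Cons q by auto
    qed
    moreover have "\<forall>c\<in>set D. c \<noteq> Map.empty" using S(3) S12 Cons by auto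
    ultimately show thesis using that[of d D] S12 S2 Cons by simp
  qed
  let ?Z = "S1 @ d # D" and ?Z' = "S1 @ d(b \<mapsto> s) # D"
  have fZ: "filling ?Z"
    using dD(1)
  proof
    assume "?Z = ?S @ [Map.empty]"
    then show ?thesis
      using S(1) by (auto simp: filling_iff spread_def sorted_wrt_append col_compat_def)
  qed (use S(1) in simp)
  have RZ: "row_word ?Z r = row_word U r" for r
    using dD(1) S(2) by (metis row_word_simps append_Nil2 option.simps(4))
  have colZ: "c q \<noteq> None" if "c \<in> set ?Z" "c r \<noteq> None" "1 \<le> q" "q \<le> r" for c r q
  proof -
    have "c \<in> set ?S" using dD(1) that by (metis Un_iff empty_iff empty_set insert_iff list.simps(15) set_append)
    then show ?thesis using col that by blast
  qed
  have rowZ: "sorted_wrt (\<lambda>c d. \<forall>r. d r \<noteq> None \<longrightarrow> c r \<noteq> None) ?Z"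
    using dD(1)
  proof
    assume "?Z = ?S @ [Map.empty]"
    then show ?thesis using row by (simp add: sorted_wrt_append)
  qed (use row in simp)
  have upper: "y \<le> s \<and> (r < b \<longrightarrow> y < s)" if "c \<in> set ?Z" "c r = Some y" "r \<le> b" for c r y
  proof -
    have "y \<in> set (row_word ?Z r)" using that in_row_word by blast
    from std[OF this[unfolded RZ]] show ?thesis using that(3) by auto
  qed
  \<comment> \<open>From d on, row b is blank and columns have no gaps, so these columns have no
    entry in row b or below it.\<close>
  have lower: "r < b" if "c \<in> set (d # D)" "c r = Some y" for c r y
  proof (rule ccontr)
    assume "\<not> r < b"
    then have "c b \<noteq> None" using colZ[of c r b] that b by auto
    then show False using bspec[OF dD(2) that(1)] by simp
  qed
  have co: "col_compat nw_order d d"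
    "\<And>e. e \<in> set S1 \<Longrightarrow> col_compat nw_order e d" "\<And>e. e \<in> set D \<Longrightarrow> col_compat nw_order d e"
    using fZ unfolding filling_iff spread_append spread_Cons by auto
  have "col_compat nw_order e (d(b \<mapsto> s))" if "e \<in> set S1" for e
  proof (rule col_compat_update_right)
    show "nw_order r' y b x" if "Some s = Some x" "e r' = Some y" for r' y x
      using upper[of e r' y] that \<open>e \<in> set S1\<close> by simp
  qed (use co(2)[OF that] in simp)
  moreover have "col_compat nw_order (d(b \<mapsto> s)) e" if "e \<in> set D" for e
  proof (rule col_compat_update_left)
    show "nw_order b x r' y" if "Some s = Some x" "e r' = Some y" for r' y x
      using lower[of e r' y] that \<open>e \<in> set D\<close> by simp
  qed (use co(3)[OF that] in simp)
  moreover have "col_compat nw_order (d(b \<mapsto> s)) (d(b \<mapsto> s))"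
  proof (rule col_compat_update_left)
    show "col_compat nw_order d (d(b \<mapsto> s))"
    proof (rule col_compat_update_right)
      show "nw_order r' y b x" if "Some s = Some x" "d r' = Some y" for r' y x
        using upper[of d r' y] that by simp
    qed (use co(1) in simp)
    show "nw_order b x r' y" if "Some s = Some x" "(d(b \<mapsto> s)) r' = Some y" for r' y x
      using that lower[of d r' y] by (auto split: if_splits)
  qed
  ultimately have "spread nw_order ?Z'"
    using fZ unfolding filling_iff spread_append spread_Cons by auto
  moreover have "\<forall>c\<in>set ?Z'. \<forall>r x. c r = Some x \<longrightarrow> 1 \<le> r \<and> 1 \<le> x"
  proof -
    have "\<forall>c\<in>set ?Z. \<forall>r x. c r = Some x \<longrightarrow> 1 \<le> r \<and> 1 \<le> x" using fZ filling_iff by blast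
    then show ?thesis using b s by auto
  qed
  ultimately have fZ': "filling ?Z'" unfolding filling_iff by blast
  have "partition_shaped ?Z'"
    unfolding partition_shaped_iff[OF fZ']
  proof
    show "\<forall>c\<in>set ?Z'. \<forall>r q. c r \<noteq> None \<longrightarrow> 1 \<le> q \<longrightarrow> q \<le> r \<longrightarrow> c q \<noteq> None"
    proof (intro ballI allI impI)
      fix c r q assume h: "c \<in> set ?Z'" "c r \<noteq> None" "1 \<le> q" "q \<le> r"
      then consider "c \<in> set ?Z" | "c = d(b \<mapsto> s)" by auto
      then show "c q \<noteq> None"
      proof cases
        case 1
        then show ?thesis using colZ h by blast
      next
        case 2
        then show ?thesis using h dD(3) colZ[of d r q] by (cases "r = b") (auto simp: le_less)
      qed
    qed
    show "sorted_wrt (\<lambda>c d. \<forall>r. d r \<noteq> None \<longrightarrow> c r \<noteq> None) ?Z'"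
      using rowZ S1 by (auto simp: sorted_wrt_append)
  qed
  moreover have "left_justified U' = ?Z'"
  proof (rule left_justified_eqI[OF f' ptableau_finite[OF U']])
    show "packed below_gt ?Z'" using fZ' \<open>partition_shaped ?Z'\<close> by (rule partition_shaped_packed)
    have "Map.empty \<noteq> d(b \<mapsto> s)" by (metis fun_upd_same option.distinct(1))
    then show "Map.empty \<notin> set ?Z'" using dD(4) S1 by auto
    have nil: "row_word D b = []" "d b = None" using dD(2) by (auto simp: row_word_eq_Nil)
    then have "row_word ?Z' r = (if r = b then row_word ?Z r @ [s] else row_word ?Z r)" for r
      by (auto split: option.split)
    then show "row_word ?Z' = row_word U'"
      unfolding fun_eq_iff RZ R by blast
  qed
  ultimately show ?thesis using semistandard_iff[OF fZ'] by (simp add: highest_weight_def)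
qed

text \<open>\<open>fin\<close> starts with \<phi>_1, so its entry at position j is \<phi>_(j+1),
  which concerns rows j+1 and j+2. The base \<open>U\<close> stays fixed while the new cell rises,
  hence one list serves all steps.\<close>

fun descend :: "nat \<Rightarrow> nat list \<Rightarrow> nat list" where
  "descend (Suc (Suc j)) fin = (if fin ! j = 0 then Suc j # descend (Suc j) fin else [])"
| "descend _ fin = []"

text \<open>In the doubled case the first i lifts the new cell to row i, and the second repeats what
  i does to the tableau without it.\<close>

fun extend_seq :: "nat list \<Rightarrow> nat list \<Rightarrow> nat \<Rightarrow> nat list \<Rightarrow> nat list" where
  "extend_seq (i # ks) (p # ps) a fin =
     (if a = Suc i \<and> p = 0 then i # i # extend_seq ks ps i fin else i # extend_seq ks ps a fin)"
| "extend_seq _ _ a fin = descend a fin"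

definition reaches_extension :: "nat \<Rightarrow> parray \<Rightarrow> nat \<Rightarrow> parray \<Rightarrow> nat list \<Rightarrow> bool" where
  "reaches_extension n U s T ks \<longleftrightarrow> set ks \<subseteq> {1..<n} \<and>
     (\<exists>U'. crystal_e_seq n ks T = Some U' \<and> highest_weight U' \<and>
        (\<exists>b \<in> {1..n}. extension n U s b U') \<and> partition_shaped (left_justified U'))"

lemma reaches_extension_Cons:
  "i \<in> {1..<n} \<Longrightarrow> crystal_e n i T = Some V \<Longrightarrow> reaches_extension n U s V ks
    \<Longrightarrow> reaches_extension n U s T (i # ks)"
  unfolding reaches_extension_def by simp

text \<open>The new cell stops at row 1 or at the first row b with \<phi>_(b-1)(U) \<noteq> 0, and
  in both cases \<open>highest_weight_extension\<close> applies.\<close>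

lemma descend_reaches:
  assumes "highest_weight U" "extension n U s b U'"
  shows "reaches_extension n U s U' (descend b (map (\<lambda>j. phi j U) [1..<n]))"
  using assms(2)
proof (induction b "map (\<lambda>j. phi j U) [1..<n]" arbitrary: U' rule: descend.induct)
  case (1 j)
  have j: "Suc j \<in> {1..<n}" using extension_row[OF 1(2)] by auto
  then have p: "map (\<lambda>j. phi j U) [1..<n] ! j = phi (Suc j) U"
    using nth_upt[of 1 j n] by simp
  show ?case
  proof (cases "phi (Suc j) U = 0")
    case True
    with crystal_e_extension_right[OF 1(2) j] obtain V
      where "crystal_e n (Suc j) U' = Some V" "extension n U s (Suc j) V" by blast
    then show ?thesis
      using 1(1) True reaches_extension_Cons[OF j] unfolding descend.simps p by simp
  next
    case False
    then have "highest_weight U' \<and> partition_shaped (left_justified U')"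
      using highest_weight_extension[OF assms(1) 1(2)] by simp
    then show ?thesis
      using False extension_row[OF 1(2)] 1(2) unfolding reaches_extension_def descend.simps p by auto
  qed
next
  case "2_1"
  then show ?case using extension_row by fastforce
next
  case "2_2"
  then have "highest_weight U' \<and> partition_shaped (left_justified U')"
    using highest_weight_extension[OF assms(1)] by simp
  then show ?case
    using extension_row[OF "2_2"] "2_2" unfolding reaches_extension_def by auto
qed

lemma extend_seq_reaches:
  assumes "set ks \<subseteq> {1..<n}" "crystal_e_seq n ks T = Some U" "highest_weight U" "extension n T s a T'"
  shows "reaches_extension n U s T' (extend_seq ks (phi_seq n ks T) a (map (\<lambda>j. phi j U) [1..<n]))"
  using assms
proof (induction ks arbitrary: T a T')
  case Nil
  then show ?case using descend_reaches by simp
next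
  case (Cons i ks)
  have i: "i \<in> {1..<n}" using Cons.prems by simp
  obtain V where V: "crystal_e n i T = Some V" "crystal_e_seq n ks V = Some U"
    using Cons.prems(2) by (auto simp: bind_eq_Some_conv)
  note IH = Cons.IH[OF _ V(2) Cons.prems(3)]
  show ?case
  proof (cases "a = Suc i \<and> phi i T = 0")
    case True
    then obtain W where W: "crystal_e n i T' = Some W" "extension n T s i W"
      using crystal_e_extension_right[OF _ i] Cons.prems(4) by blast
    \<comment> \<open>The new cell now lies in row i, not i+1, so the regular case applies even
      though \<phi>_i(T) = 0.\<close>
    from crystal_e_extension_left[OF W(2) i V(1)] obtain V'
      where V': "crystal_e n i W = Some V'" "extension n V s i V'" by auto
    show ?thesis
      using IH[OF _ V'(2)] Cons.prems(1) True V(1)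
        reaches_extension_Cons[OF i W(1)] reaches_extension_Cons[OF i V'(1)] by simp
  next
    case False
    then obtain V' where V': "crystal_e n i T' = Some V'" "extension n V s a V'"
      using crystal_e_extension_left[OF Cons.prems(4) i V(1)] by auto
    show ?thesis
      using IH[OF _ V'(2)] Cons.prems(1) False V(1) reaches_extension_Cons[OF i V'(1)] by auto
  qed
qed

theorem theorem3p1:
  fixes n :: nat
  shows "\<exists>E :: nat list \<Rightarrow> nat list \<Rightarrow> nat \<Rightarrow> nat list \<Rightarrow> nat list.
    \<forall>T ks U a s T'.
      ptableau n T \<longrightarrow> set ks \<subseteq> {1..<n} \<longrightarrow>
      crystal_e_seq n ks T = Some U \<longrightarrow> highest_weight U \<longrightarrow>
      extension n T s a T' \<longrightarrow>
      (let ks' = E ks (phi_seq n ks T) a (map (\<lambda>j. phi j U) [1..<n])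
       in set ks' \<subseteq> {1..<n} \<and>
          (\<exists>U'. crystal_e_seq n ks' T' = Some U' \<and> highest_weight U' \<and>
             (\<exists>b \<in> {1..n}. extension n U s b U') \<and>
             partition_shaped (left_justified U')))"
  using extend_seq_reaches unfolding reaches_extension_def Let_def by (intro exI[of _ extend_seq]) blast

end
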